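(* Let $(\rho,\overline{J})$ be a pair of smoothly decaying functions, $\rho$ real valued and $\overline{J}$ $\mathbb{R}^{3}$-valued, satisfying the continuity equation $\frac{\partial\rho}{\partial t}+\nabla\cdot\overline{J}=0$ and the wave equations $\square^{2}(\rho)=0$ and $\square^{2}(\overline{J})=\overline{0}$, with the additional equation $$\nabla\rho+\frac{1}{c^{2}}\frac{\partial\overline{J}}{\partial t}=\overline{0}.$$ (1) If $$\rho(\overline{x},t)=\int_{\mathbb{R}^{3}}f(\overline{k})e^{i(\overline{k}\cdot\overline{x}-\omega(\overline{k})t)}\,d\overline{k}+\int_{\mathbb{R}^{3}}g(\overline{k})e^{i(\overline{k}\cdot\overline{x}+\omega(\overline{k})t)}\,d\overline{k},$$ $$\overline{J}(\overline{x},t)=\int_{\mathbb{R}^{3}}\overline{F}(\overline{k})e^{i(\overline{k}\cdot\overline{x}-\omega(\overline{k})t)}\,d\overline{k}+\int_{\mathbb{R}^{3}}\overline{G}(\overline{k})e^{i(\overline{k}\cdot\overline{x}+\omega(\overline{k})t)}\,d\overline{k},$$ then, for $\overline{k}\neq\overline{0}$, $$\overline{F}(\overline{k})=\frac{c f(\overline{k})\overline{k}}{|\overline{k}|},\qquad f(\overline{k})=\frac{(\overline{k},\overline{F}(\overline{k}))}{c|\overline{k}|},\qquad \overline{G}(\overline{k})=-\frac{c g(\overline{k})\overline{k}}{|\overline{k}|},\qquad g(\overline{k})=-\frac{(\overline{k},\overline{G}(\overline{k}))}{c|\overline{k}|}.$$ (2) If $\overline{J}$ is tangential, that is, $(\overline{x},\overline{J}(\overline{x},t))=0$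 for all $\overline{x}\neq\overline{0}$ and $t\in\mathbb{R}_{\geq 0}$, then the pair $(\rho,\overline{J})$ is trivial, that is, $\rho=0$ and $\overline{J}=\overline{0}$.
   Context: $\epsilon_{0},\mu_{0}>0$ are constants, $c=1/\sqrt{\mu_{0}\epsilon_{0}}$, $\omega(\overline{k})=c|\overline{k}|$, and $\square^{2}=\nabla^{2}-\frac{1}{c^{2}}\frac{\partial^{2}}{\partial t^{2}}$, acting componentwise on vector fields. A function on $\mathbb{R}^{3}\times\mathbb{R}$ is smoothly decaying if it is $C^{\infty}$ and, for every $t\in\mathbb{R}$, its restriction to time $t$ lies in the Schwartz class $\mathcal{S}(\mathbb{R}^{3})$; a vector field is smoothly decaying if each component is. $(\cdot,\cdot)$ denotes the bilinear dot product $(\overline{a},\overline{b})=\sum_{i}a_{i}b_{i}$. In the representation of $\rho$ and $\overline{J}$ in (1), the coefficient functions $f,g$ and the components of $\overline{F},\overline{G}$ are (complex-valued) functions in the Schwartz class $\mathcal{S}(\mathbb{R}^{3})$. *)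

theory Defs
  imports "HOL-Analysis.Analysis"
begin

definition dir_deriv :: "'a::real_normed_vector \<Rightarrow> ('a \<Rightarrow> 'b::real_normed_vector) \<Rightarrow> 'a \<Rightarrow> 'b" where
  "dir_deriv v f = (\<lambda>x. frechet_derivative f (at x) v)"

text \<open>\<open>iter_partial [v\<^sub>1, \<dots>, v\<^sub>m] f\<close> is \<open>\<partial>\<^bsub>v\<^sub>1\<^esub> \<dots> \<partial>\<^bsub>v\<^sub>m\<^esub> f\<close>. Taking lists of basis vectors yields all iterated
  partial derivatives.\<close>

definition iter_partial :: "'a::real_normed_vector list \<Rightarrow> ('a \<Rightarrow> 'b::real_normed_vector) \<Rightarrow> 'a \<Rightarrow> 'b" where
  "iter_partial vs f = foldr dir_deriv vs f"

text \<open>Infinite differentiability: the derivatives of every order are again (totally)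
  differentiable, hence continuous. Differentiability is imposed at every order, so the
  junk values of \<^const>\<open>frechet_derivative\<close> never occur for such functions.\<close>

definition C_infinity :: "('a::euclidean_space \<Rightarrow> 'b::real_normed_vector) \<Rightarrow> bool" where
  "C_infinity f \<longleftrightarrow>
     (\<forall>vs. set vs \<subseteq> Basis \<longrightarrow> (\<forall>x. iter_partial vs f differentiable (at x)))"

definition schwartz :: "('a::euclidean_space \<Rightarrow> 'b::real_normed_vector) \<Rightarrow> bool" where
  "schwartz f \<longleftrightarrow> C_infinity f \<and>
     (\<forall>n::nat. \<forall>vs. set vs \<subseteq> Basis \<longrightarrow>
        bounded (range (\<lambda>x. norm x ^ n *\<^sub>R iter_partial vs f x)))"

type_synonym spacetime = "(real^3) \<times> real"

definition smoothly_decaying :: "(spacetime \<Rightarrow> 'b::real_normed_vector) \<Rightarrow> bool" where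
  "smoothly_decaying u \<longleftrightarrow> C_infinity u \<and> (\<forall>t. schwartz (\<lambda>x. u (x, t)))"

definition smoothly_decaying_field :: "(spacetime \<Rightarrow> real^3) \<Rightarrow> bool" where
  "smoothly_decaying_field V \<longleftrightarrow> (\<forall>i. smoothly_decaying (\<lambda>p. V p $ i))"

definition space_deriv :: "3 \<Rightarrow> (spacetime \<Rightarrow> 'b::real_normed_vector) \<Rightarrow> spacetime \<Rightarrow> 'b" where
  "space_deriv i = dir_deriv (axis i 1, 0)"

definition time_deriv :: "(spacetime \<Rightarrow> 'b::real_normed_vector) \<Rightarrow> spacetime \<Rightarrow> 'b" where
  "time_deriv = dir_deriv (0, 1)"

definition gradient :: "(spacetime \<Rightarrow> real) \<Rightarrow> spacetime \<Rightarrow> real^3" where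
  "gradient u p = (\<chi> i. space_deriv i u p)"

definition divergence :: "(spacetime \<Rightarrow> real^3) \<Rightarrow> spacetime \<Rightarrow> real" where
  "divergence V p = (\<Sum>i\<in>UNIV. space_deriv i (\<lambda>q. V q $ i) p)"

definition laplacian :: "(spacetime \<Rightarrow> real) \<Rightarrow> spacetime \<Rightarrow> real" where
  "laplacian u p = (\<Sum>i\<in>UNIV. space_deriv i (space_deriv i u) p)"

definition dalembertian :: "real \<Rightarrow> (spacetime \<Rightarrow> real) \<Rightarrow> spacetime \<Rightarrow> real" where
  "dalembertian c u p = laplacian u p - 1 / c\<^sup>2 * time_deriv (time_deriv u) p"

definition dalembertian_field :: "real \<Rightarrow> (spacetime \<Rightarrow> real^3) \<Rightarrow> spacetime \<Rightarrow> real^3" where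
  "dalembertian_field c V p = (\<chi> i. dalembertian c (\<lambda>q. V q $ i) p)"

definition angular_freq :: "real \<Rightarrow> real^3 \<Rightarrow> real" where
  "angular_freq c k = c * norm k"

definition cvec :: "real^'n \<Rightarrow> complex^'n" where
  "cvec v = (\<chi> i. complex_of_real (v $ i))"

text \<open>The dot product on complex vectors is bilinear: unlike in a Hermitian product, neither
  argument is conjugated.\<close>

definition bilin_dot :: "complex^'n \<Rightarrow> complex^'n \<Rightarrow> complex" where
  "bilin_dot a b = (\<Sum>i\<in>UNIV. a $ i * b $ i)"

end

theory Submission
  imports Defs "HOL-Probability.Probability"
begin

text \<open>Both parts rest on the extra equation, which couples each component \<open>J\<^sub>i\<close> to \<open>\<rho>\<close> by
  \<open>\<partial>\<^sub>i \<rho> = - \<partial>\<^sub>t J\<^sub>i / c\<^sup>2\<close>.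

  For the first part, insert the two representations into this coupling and differentiate under
  the integral sign. At each time \<open>t\<close> it becomes the vanishing of the Fourier transform of
  \<open>a(k) e\<^bsup>-i\<omega>t\<^esup> + b(k) e\<^bsup>i\<omega>t\<^esup>\<close>, with, up to a factor \<open>i\<close>, \<open>a = k\<^sub>i f - \<omega> F\<^sub>i / c\<^sup>2\<close> and
  \<open>b = k\<^sub>i g + \<omega> G\<^sub>i / c\<^sup>2\<close>. These functions are continuous and integrable, so by
  \<open>fourier_uniqueness\<close> the combination vanishes pointwise; since \<open>\<omega>(k) \<noteq> 0\<close>, comparing the
  times \<open>0\<close> and \<open>\<pi> / (2\<omega>)\<close> separates the two phases and gives \<open>a = b = 0\<close>
  (\<open>two_wave_packets_uniqueness\<close>). This determines \<open>F\<close> and \<open>G\<close>; the formulas for \<open>f\<close> and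
  \<open>g\<close> follow by pairing with \<open>k\<close>.

  For the second part, consider first a time \<open>t > 0\<close>. Differentiating \<open>x \<bullet> J(x, t) = 0\<close> in
  time gives \<open>x \<bullet> \<nabla>\<rho> = 0\<close>: the charge density is constant on rays, and as it decays at
  infinity it is zero. The coupling now yields \<open>\<partial>\<^sub>t J = 0\<close>, so by the wave equation every
  component of \<open>J\<close> is a harmonic function of \<open>x\<close> that tends to zero, hence is zero by the maximum
  principle.

  It remains to go back to times \<open>t \<le> 0\<close>. Decay in \<open>x\<close> is only known for each time separately,
  without uniformity, so global energy integrals cannot be differentiated in time. Instead one
  localises. Continuity equation and extra equation form the first order system of linear
  acoustics, whose energy density
  \<open>e = (\<rho>\<^sup>2 + |J|\<^sup>2 / c\<^sup>2) / 2\<close> satisfies the conservation law \<open>\<partial>\<^sub>t e + \<nabla> \<bullet> (\<rho> J) = 0\<close> with flux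
  bounded by \<open>c e\<close>. Multiply by a weight which is supported in a region opening towards the future
  at a speed of at most \<open>c\<close>. Because the fields vanish for \<open>t > 0\<close>, the weighted current
  has compact support in spacetime, so its divergence integrates to zero; but that divergence is
  nonnegative, hence it is identically zero, and this forces \<open>e = 0\<close>
  (\<open>acoustic_backward_uniqueness\<close>).\<close>

section \<open>Uniqueness of the Fourier transform\<close>

text \<open>Lebesgue measure on a Euclidean space is the image of the product of the Lebesgue measures on the
  coordinate axes, so Fubini's theorem splits integrals of products of functions of one coordinate each.\<close>

lemma lborel_product_function:
  fixes f :: "'a::euclidean_space \<Rightarrow> real \<Rightarrow> 'b::{real_normed_field,banach,second_countable_topology}"
  assumes "\<And>b. b \<in> Basis \<Longrightarrow> integrable lborel (f b)"
  shows integrable_lborel_product_function: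
      "integrable lborel (\<lambda>x::'a. \<Prod>b\<in>Basis. f b (x \<bullet> b))"
    and integral_lborel_product_function:
      "(LINT x|lborel. (\<Prod>b\<in>Basis. f b (x \<bullet> b))) = (\<Prod>b\<in>Basis. LINT y|lborel. f b y)"
proof -
  interpret product_sigma_finite "\<lambda>_::'a. lborel :: real measure"
    by standard
  have [measurable]: "f b \<in> borel_measurable borel" if "b \<in> Basis" for b
    using assms[OF that] by simp
  have [measurable]: "(\<lambda>x::'a. \<Prod>b\<in>Basis. f b (x \<bullet> b)) \<in> borel_measurable borel"
    by measurable
  show "integrable lborel (\<lambda>x::'a. \<Prod>b\<in>Basis. f b (x \<bullet> b))"
    unfolding lborel_eq[where 'a='a]
    by (subst integrable_distr_eq) (auto simp: assms intro!: product_integrable_prod)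
  show "(LINT x|lborel. (\<Prod>b\<in>Basis. f b (x \<bullet> b))) = (\<Prod>b\<in>Basis. LINT y|lborel. f b y)"
    unfolding lborel_eq[where 'a='a]
    by (subst integral_distr) (auto simp: assms intro!: product_integral_prod)
qed

lemma power2_norm_eq_sum_Basis: "(norm x)\<^sup>2 = (\<Sum>b\<in>Basis. (x \<bullet> b)\<^sup>2)"
  for x :: "'a::euclidean_space"
  by (subst power2_norm_eq_inner, subst euclidean_inner) (simp only: power2_eq_square)

lemma exp_norm_square_eq_prod:
  "exp (- (norm x)\<^sup>2 / 2) = (\<Prod>b\<in>Basis. exp (- (x \<bullet> b)\<^sup>2 / 2))"
  for x :: "'a::euclidean_space"
proof -
  have "- (norm x)\<^sup>2 / 2 = (\<Sum>b\<in>Basis. - (x \<bullet> b)\<^sup>2 / 2)"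
    unfolding power2_norm_eq_sum_Basis by (simp add: sum_negf sum_divide_distrib)
  then show ?thesis by (simp only: exp_sum finite_Basis)
qed

definition gaussian :: "'a::euclidean_space \<Rightarrow> real" where
  "gaussian x = (\<Prod>b\<in>Basis. std_normal_density (x \<bullet> b))"

lemma gaussian_eq_exp:
  "exp (- (norm x)\<^sup>2 / 2) = sqrt (2 * pi) ^ DIM('a) * gaussian (x :: 'a::euclidean_space)"
proof -
  have "exp (- (norm x)\<^sup>2 / 2) = (\<Prod>b\<in>Basis. exp (- (x \<bullet> b)\<^sup>2 / 2))"
    by (rule exp_norm_square_eq_prod)
  also have "\<dots> = (\<Prod>b\<in>Basis. sqrt (2 * pi) * std_normal_density (x \<bullet> b))"
    by (intro prod.cong) (auto simp: std_normal_density_def)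
  finally show ?thesis
    by (simp add: prod.distrib gaussian_def)
qed

lemma integrable_gaussian: "integrable lborel (gaussian :: 'a::euclidean_space \<Rightarrow> real)"
  unfolding gaussian_def[abs_def]
  by (intro integrable_lborel_product_function) simp

lemma integral_gaussian: "(LINT x|lborel. gaussian (x :: 'a::euclidean_space)) = 1"
  unfolding gaussian_def by (subst integral_lborel_product_function) auto

text \<open>Up to a constant factor the Gaussian density is its own Fourier transform. In one dimension this is
  the characteristic function of the standard normal distribution.\<close>

lemma fourier_gaussian:
  fixes y :: "'a::euclidean_space"
  shows "(LINT x|lborel. of_real (gaussian x) * exp (\<i> * of_real (y \<bullet> x)))
    = (of_real (exp (- (norm y)\<^sup>2 / 2)) :: complex)"
proof -
  have int: "integrable lborel (\<lambda>z. complex_of_real (std_normal_density z) * exp (\<i> * of_real (t * z)))" for t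
    by (rule Bochner_Integration.integrable_bound[of _ std_normal_density]) (auto simp: norm_mult)
  have "(LINT x|lborel. of_real (gaussian x) * exp (\<i> * of_real (y \<bullet> x)))
     = (LINT x|lborel. (\<Prod>b\<in>Basis. of_real (std_normal_density (x \<bullet> b)) * exp (\<i> * of_real ((y \<bullet> b) * (x \<bullet> b))))) "
  proof (rule Bochner_Integration.integral_cong[OF refl])
    fix x :: 'a
    have "exp (\<i> * of_real (y \<bullet> x)) = (\<Prod>b\<in>Basis. exp (\<i> * of_real ((y \<bullet> b) * (x \<bullet> b))))"
      by (subst euclidean_inner) (simp add: sum_distrib_left exp_sum)
    then show "of_real (gaussian x) * exp (\<i> * of_real (y \<bullet> x)) =
        (\<Prod>b\<in>Basis. of_real (std_normal_density (x \<bullet> b)) * exp (\<i> * of_real ((y \<bullet> b) * (x \<bullet> b))))"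
      by (simp only: gaussian_def prod.distrib of_real_prod)
  qed
  also have "\<dots> = (\<Prod>b\<in>Basis. LINT z|lborel. of_real (std_normal_density z) * exp (\<i> * of_real ((y \<bullet> b) * z)))"
    by (rule integral_lborel_product_function[OF int])
  also have "\<dots> = (\<Prod>b\<in>Basis. of_real (exp (- (y \<bullet> b)\<^sup>2 / 2)))"
  proof (rule prod.cong[OF refl])
    fix b :: 'a
    show "(LINT z|lborel. of_real (std_normal_density z) * exp (\<i> * of_real ((y \<bullet> b) * z)))
        = complex_of_real (exp (- (y \<bullet> b)\<^sup>2 / 2))"
      using fun_cong[OF char_std_normal_distribution, of "y \<bullet> b"]
      unfolding char_def by (subst (asm) integral_density) (auto simp: scaleR_conv_of_real)
  qed
  also have "\<dots> = of_real (exp (- (norm y)\<^sup>2 / 2))"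
    unfolding exp_norm_square_eq_prod by simp
  finally show ?thesis .
qed

lemma lborel_integral_affine:
  fixes f :: "'a::euclidean_space \<Rightarrow> complex"
  assumes [measurable]: "f \<in> borel_measurable borel" and "s > 0"
  shows "(LINT x|lborel. f x) = of_real (s ^ DIM('a)) * (LINT x|lborel. f (a + s *\<^sub>R x))"
  using assms(2)
  by (subst lborel_affine[of s a])
     (auto simp: integral_density integral_distr scaleR_conv_of_real)

lemma lborel_integrable_affine:
  fixes f :: "'a::euclidean_space \<Rightarrow> complex"
  assumes f: "integrable lborel f" and "s > 0"
  shows "integrable lborel (\<lambda>x. f (a + s *\<^sub>R x))"
proof -
  have [measurable]: "f \<in> borel_measurable borel" using f by simp
  have "integrable lborel (\<lambda>x. s ^ DIM('a) *\<^sub>R f (a + s *\<^sub>R x))"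
    using assms
    by (subst (asm) lborel_affine[of s a]) (auto simp: integrable_density integrable_distr_eq)
  then have "integrable lborel (\<lambda>x. inverse (s ^ DIM('a)) *\<^sub>R (s ^ DIM('a) *\<^sub>R f (a + s *\<^sub>R x)))"
    by (rule integrable_scaleR_right)
  then show ?thesis using \<open>s > 0\<close> by simp
qed

text \<open>Rescaling around \<open>a\<close> keeps the hypothesis on the Fourier transform. Integrated against the
  Gaussian and combined with Fubini's theorem, it shows that \<open>h(a + s y)\<close> integrates to zero against
  the transform of the Gaussian, which is again a multiple of the Gaussian. As \<open>s\<close> tends to zero these
  averages converge to a multiple of \<open>h a\<close>.\<close>

lemma fourier_uniqueness:
  fixes h :: "'a::euclidean_space \<Rightarrow> complex"
  assumes cont: "continuous_on UNIV h" and bound: "\<And>x. norm (h x) \<le> B"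
    and int: "integrable lborel h"
    and zero: "\<And>x. (LINT k|lborel. h k * exp (\<i> * of_real (k \<bullet> x))) = 0"
  shows "h a = 0"
proof -
  have [measurable]: "h \<in> borel_measurable borel"
    using cont by (rule borel_measurable_continuous_onI)
  define K where "K = sqrt (2 * pi) ^ DIM('a)"
  have K: "K \<noteq> 0" by (simp add: K_def)
  have "continuous_on UNIV (gaussian :: 'a \<Rightarrow> real)"
    unfolding gaussian_def[abs_def] std_normal_density_def by (intro continuous_intros) auto
  then have [measurable]: "(gaussian :: 'a \<Rightarrow> real) \<in> borel_measurable borel"
    by (rule borel_measurable_continuous_onI)
  have g0: "gaussian x \<ge> 0" for x :: 'a
    by (simp add: gaussian_def prod_nonneg)
  \<comment> \<open>The substitution \<open>k = a + s y\<close> in the transform at frequency \<open>x / s\<close>.\<close>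
  have A: "(LINT y|lborel. h (a + s *\<^sub>R y) * exp (\<i> * of_real (y \<bullet> x))) = 0" if s: "s > 0" for s x
  proof -
    have "0 = (LINT k|lborel. h k * exp (\<i> * of_real (k \<bullet> (x /\<^sub>R s))))"
      by (rule zero[symmetric])
    also have "\<dots> = of_real (s ^ DIM('a)) *
       (LINT y|lborel. h (a + s *\<^sub>R y) * exp (\<i> * of_real ((a + s *\<^sub>R y) \<bullet> (x /\<^sub>R s))))"
      by (rule lborel_integral_affine) (use s in auto)
    also have "(\<lambda>y. h (a + s *\<^sub>R y) * exp (\<i> * of_real ((a + s *\<^sub>R y) \<bullet> (x /\<^sub>R s))))
      = (\<lambda>y. exp (\<i> * of_real (a \<bullet> (x /\<^sub>R s))) * (h (a + s *\<^sub>R y) * exp (\<i> * of_real (y \<bullet> x))))"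
    proof
      fix y
      have "(a + s *\<^sub>R y) \<bullet> (x /\<^sub>R s) = a \<bullet> (x /\<^sub>R s) + y \<bullet> x"
        using s by (simp add: inner_add_left field_simps)
      then show "h (a + s *\<^sub>R y) * exp (\<i> * of_real ((a + s *\<^sub>R y) \<bullet> (x /\<^sub>R s)))
        = exp (\<i> * of_real (a \<bullet> (x /\<^sub>R s))) * (h (a + s *\<^sub>R y) * exp (\<i> * of_real (y \<bullet> x)))"
        by (simp only: of_real_add distrib_left exp_add mult_ac)
    qed
    finally show ?thesis using s by simp
  qed
  \<comment> \<open>Write the Gaussian in \<open>y\<close> as a Fourier transform and exchange the integrals.\<close>
  have B: "(LINT y|lborel. h (a + s *\<^sub>R y) * of_real (exp (- (norm y)\<^sup>2 / 2))) = 0" if s: "s > 0" for s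
  proof -
    let ?H = "\<lambda>y x. h (a + s *\<^sub>R y) * (of_real (gaussian x) * exp (\<i> * of_real (y \<bullet> x)))"
    have i1: "integrable lborel (\<lambda>y. h (a + s *\<^sub>R y))"
      using int s by (rule lborel_integrable_affine)
    have i2: "integrable lborel (\<lambda>x. of_real (gaussian x) * exp (\<i> * of_real (y \<bullet> x)) :: complex)" for y :: 'a
      by (rule Bochner_Integration.integrable_bound[OF integrable_gaussian])
         (auto simp: norm_mult g0)
    have ig: "integrable (lborel \<Otimes>\<^sub>M lborel) (\<lambda>(y, x). ?H y x)"
    proof (rule lborel_pair.Fubini_integrable)
      show "(\<lambda>(y, x). ?H y x) \<in> borel_measurable (lborel \<Otimes>\<^sub>M lborel)"
        by measurable
      show "AE y in lborel. integrable lborel (\<lambda>x. case (y, x) of (y, x) \<Rightarrow> ?H y x)"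
        using i2 by simp
      have "(LINT x|lborel. norm (?H y x)) = norm (h (a + s *\<^sub>R y))" for y
        by (simp add: norm_mult g0 integral_gaussian)
      then show "integrable lborel (\<lambda>y. LINT x|lborel. norm (case (y, x) of (y, x) \<Rightarrow> ?H y x))"
        using i1 by simp
    qed
    have "(LINT y|lborel. h (a + s *\<^sub>R y) * of_real (exp (- (norm y)\<^sup>2 / 2)))
       = (LINT y|lborel. LINT x|lborel. ?H y x)"
      by (simp only: integral_mult_right_zero fourier_gaussian)
    also have "\<dots> = (LINT x|lborel. LINT y|lborel. ?H y x)"
      using lborel_pair.Fubini_integral[OF ig] by simp
    also have "\<dots> = (LINT x|lborel. LINT y|lborel.
        of_real (gaussian x) * (h (a + s *\<^sub>R y) * exp (\<i> * of_real (y \<bullet> x))))"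
      by (simp add: ac_simps)
    also have "\<dots> = 0"
      by (simp only: integral_mult_right_zero A[OF s]) simp
    finally show ?thesis .
  qed
  have lim: "(\<lambda>n. LINT y|lborel. h (a + inverse (real (Suc n)) *\<^sub>R y) * of_real (gaussian y))
      \<longlonglongrightarrow> (LINT (y::'a)|lborel. h a * of_real (gaussian y))"
  proof (rule integral_dominated_convergence[where w="\<lambda>y::'a. B * gaussian y"])
    show "integrable lborel (\<lambda>y::'a. B * gaussian y)"
      by (intro integrable_mult_right integrable_gaussian)
    have "(\<lambda>n. h (a + inverse (real (Suc n)) *\<^sub>R y)) \<longlonglongrightarrow> h (a + 0 *\<^sub>R y)" for y
      by (intro continuous_on_tendsto_compose[OF cont] tendsto_intros LIMSEQ_inverse_real_of_nat) auto
    then show "AE y in lborel. (\<lambda>n. h (a + inverse (real (Suc n)) *\<^sub>R y) * of_real (gaussian y))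
        \<longlonglongrightarrow> h a * of_real (gaussian y)"
      by (auto intro!: tendsto_mult_right simp del: of_nat_Suc)
  qed (use bound in \<open>auto simp: norm_mult g0 intro!: mult_right_mono\<close>)
  have "(LINT y|lborel. h (a + inverse (real (Suc n)) *\<^sub>R y) * of_real (gaussian y)) = 0" for n
  proof -
    have "of_real K * (LINT y|lborel. h (a + inverse (real (Suc n)) *\<^sub>R y) * of_real (gaussian y))
      = (LINT y|lborel. h (a + inverse (real (Suc n)) *\<^sub>R y) * of_real (exp (- (norm y)\<^sup>2 / 2)))"
      unfolding gaussian_eq_exp K_def[symmetric]
      by (subst integral_mult_right_zero[symmetric]) (simp add: ac_simps)
    also have "\<dots> = 0" by (rule B) simp
    finally have "of_real K * (LINT y|lborel. h (a + inverse (real (Suc n)) *\<^sub>R y) * of_real (gaussian y)) = 0" .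
    with K show ?thesis by simp
  qed
  with lim have "(LINT (y::'a)|lborel. h a * of_real (gaussian y)) = 0"
    by (simp add: LIMSEQ_const_iff)
  then show ?thesis
    by (simp add: integral_gaussian)
qed

section \<open>Derivatives along lines in spacetime\<close>

lemma frechet_has_real_derivative_line:
  fixes f :: "'a::real_normed_vector \<Rightarrow> real"
  assumes "f differentiable (at p)"
  shows "((\<lambda>s. f (p + s *\<^sub>R v)) has_real_derivative dir_deriv v f p) (at 0)"
proof -
  have 1: "(f has_derivative frechet_derivative f (at p)) (at (p + 0 *\<^sub>R v))"
    using assms by (simp add: frechet_derivative_works)
  have 2: "((\<lambda>s. p + s *\<^sub>R v) has_derivative (\<lambda>s. s *\<^sub>R v)) (at (0::real))"
    by (auto intro!: derivative_eq_intros)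
  have "((\<lambda>s. f (p + s *\<^sub>R v)) has_derivative (\<lambda>s. frechet_derivative f (at p) (s *\<^sub>R v))) (at 0)"
    using has_derivative_compose[OF 2 1] by simp
  moreover have "frechet_derivative f (at p) (s *\<^sub>R v) = dir_deriv v f p * s" for s
    using linear_frechet_derivative[OF assms] by (simp add: linear_scale dir_deriv_def)
  ultimately show ?thesis
    by (simp add: has_field_derivative_def)
qed

lemma C_infinity_differentiable: "C_infinity f \<Longrightarrow> f differentiable (at x)"
  unfolding C_infinity_def iter_partial_def by (drule spec[of _ "[]"]) simp

lemma C_infinity_dir_deriv:
  assumes "C_infinity f" "v \<in> Basis" shows "C_infinity (dir_deriv v f)"
  unfolding C_infinity_def
proof (intro allI impI)
  fix vs :: "'a list" and x assume "set vs \<subseteq> Basis"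
  then have "iter_partial (vs @ [v]) f differentiable (at x)"
    using assms unfolding C_infinity_def by (auto simp del: Basis_prod_def)
  then show "iter_partial vs (dir_deriv v f) differentiable (at x)"
    by (simp add: iter_partial_def)
qed

lemma C_infinity_continuous: "C_infinity f \<Longrightarrow> continuous_on UNIV f"
  by (meson C_infinity_differentiable continuous_at_imp_continuous_on differentiable_imp_continuous_within)

lemma axis_in_Basis_spacetime: "(axis i 1, 0) \<in> (Basis :: spacetime set)" "(0, 1) \<in> (Basis :: spacetime set)"
  by (auto simp: Basis_prod_def Basis_vec_def)

lemma dir_deriv_vec_nth:
  fixes V :: "'a::real_normed_vector \<Rightarrow> real^'n"
  assumes "\<And>i. (\<lambda>q. V q $ i) differentiable (at p)"
  shows "dir_deriv v V p $ i = dir_deriv v (\<lambda>q. V q $ i) p"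
proof -
  let ?V' = "\<lambda>v. \<chi> i. frechet_derivative (\<lambda>q. V q $ i) (at p) v"
  have "(V has_derivative ?V') (at p)"
    unfolding has_derivative_componentwise_within[of V]
  proof
    fix b :: "real^'n" assume "b \<in> Basis"
    then obtain i where b: "b = axis i 1" by (auto simp: Basis_vec_def)
    show "((\<lambda>x. V x \<bullet> b) has_derivative (\<lambda>x. ?V' x \<bullet> b)) (at p)"
      using assms[of i] by (simp add: b inner_axis frechet_derivative_works)
  qed
  then have "frechet_derivative V (at p) = ?V'"
    by (rule frechet_derivative_at[symmetric])
  then show ?thesis by (simp add: dir_deriv_def)
qed

lemma dir_deriv_spatial:
  fixes f :: "spacetime \<Rightarrow> real"
  assumes "f differentiable (at p)"
  shows "dir_deriv (x, 0) f p = (\<Sum>i\<in>UNIV. x $ i * space_deriv i f p)"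
proof -
  have "(x, 0) = (\<Sum>i\<in>UNIV. (x $ i) *\<^sub>R (axis i 1, 0 :: real))"
    by (simp add: prod_eq_iff fst_sum snd_sum vec_eq_iff axis_def if_distrib cong: if_cong)
  then show ?thesis
    using linear_frechet_derivative[OF assms]
    by (simp add: dir_deriv_def space_deriv_def linear_sum linear_scale del: scaleR_Pair)
qed

lemma line_derivative_shift:
  fixes f :: "'a::real_normed_vector \<Rightarrow> real"
  assumes "\<And>x. ((\<lambda>s. f (x + s *\<^sub>R v)) has_real_derivative f' x) (at 0)"
  shows "((\<lambda>s. f (p + s *\<^sub>R v)) has_real_derivative f' (p + s *\<^sub>R v)) (at s)"
proof -
  have "((\<lambda>u. f ((p + s *\<^sub>R v) + (u + - s) *\<^sub>R v)) has_real_derivative f' (p + s *\<^sub>R v)) (at s)"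
    using assms[of "p + s *\<^sub>R v"] by (subst DERIV_shift[symmetric]) (simp add: o_def)
  then show ?thesis by (simp add: algebra_simps)
qed

lemma DERIV_zero_near:
  fixes f :: "real \<Rightarrow> real"
  assumes "(f has_real_derivative D) (at 0)" and "d > 0" and "\<And>s. \<bar>s\<bar> < d \<Longrightarrow> f s = 0"
  shows "D = 0"
proof -
  have "(f has_real_derivative 0) (at 0)"
    by (rule has_field_derivative_transform_within[of "\<lambda>_. 0" _ _ _ d]) (use assms in \<open>auto simp: dist_real_def\<close>)
  with assms(1) show ?thesis by (rule DERIV_unique)
qed

section \<open>Schwartz functions and oscillatory integrals\<close>

text \<open>The weight \<open>\<Prod>\<^sub>b 1 / (1 + x\<^sub>b\<^sup>2)\<close> is integrable because it factors over the coordinates, and its inverse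
  is at most \<open>(1 + |x|\<^sup>2)\<^sup>d\<close> in dimension \<open>d\<close>; so the decay of order \<open>2d\<close> suffices.\<close>

lemma integrable_rapidly_decreasing:
  fixes f :: "'a::euclidean_space \<Rightarrow> 'b::{banach,second_countable_topology}"
  assumes [measurable]: "f \<in> borel_measurable borel"
    and decay: "\<And>n::nat. bounded (range (\<lambda>x. norm x ^ n *\<^sub>R f x))"
  shows "integrable lborel f"
proof -
  let ?w = "\<lambda>y::real. inverse (1 + y\<^sup>2)"
  let ?d = "DIM('a)"
  have "integrable lborel ?w"
    using integrable_inverse_1_plus_square by (simp add: set_integrable_def)
  then have iw: "integrable lborel (\<lambda>x::'a. \<Prod>b\<in>Basis. ?w (x \<bullet> b))"
    by (rule integrable_lborel_product_function)
  obtain C0 where C0: "\<And>x. norm (f x) \<le> C0"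
    using decay[of 0] by (auto simp: bounded_iff)
  obtain C1 where C1: "\<And>x. norm x ^ (2 * ?d) * norm (f x) \<le> C1"
    using decay[of "2 * ?d"] by (auto simp: bounded_iff)
  have bound: "norm (f x) \<le> 2 ^ ?d * (C0 + C1) * (\<Prod>b\<in>Basis. ?w (x \<bullet> b))" for x
  proof -
    have "(\<Prod>b\<in>Basis. 1 + (x \<bullet> b)\<^sup>2) \<le> (\<Prod>b\<in>(Basis::'a set). 1 + (norm x)\<^sup>2)"
      by (intro prod_mono) (auto intro!: power_mono simp: Basis_le_norm abs_le_square_iff[symmetric])
    also have "\<dots> = (1 + (norm x)\<^sup>2) ^ ?d" by simp
    also have "\<dots> \<le> (2 * max 1 ((norm x)\<^sup>2)) ^ ?d"
      by (intro power_mono) auto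
    also have "\<dots> \<le> 2 ^ ?d * (1 + norm x ^ (2 * ?d))"
      by (auto simp: max_def power_mult_distrib simp flip: power_mult)
    finally have le: "(\<Prod>b\<in>Basis. 1 + (x \<bullet> b)\<^sup>2) \<le> 2 ^ ?d * (1 + norm x ^ (2 * ?d))" .
    have "(\<Prod>b\<in>Basis. 1 + (x \<bullet> b)\<^sup>2) * norm (f x) \<le> 2 ^ ?d * (1 + norm x ^ (2 * ?d)) * norm (f x)"
      by (intro mult_right_mono le) simp
    also have "\<dots> = 2 ^ ?d * (norm (f x) + norm x ^ (2 * ?d) * norm (f x))"
      by (simp only: distrib_right mult_1 mult.assoc)
    also have "\<dots> \<le> 2 ^ ?d * (C0 + C1)"
      using C0[of x] C1[of x] by (intro mult_left_mono add_mono) auto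
    finally have "(\<Prod>b\<in>Basis. 1 + (x \<bullet> b)\<^sup>2) * norm (f x) \<le> 2 ^ ?d * (C0 + C1)" .
    moreover have "(\<Prod>b\<in>Basis. 1 + (x \<bullet> b)\<^sup>2) > 0"
      by (intro prod_pos) (auto simp: add_pos_nonneg)
    moreover have "(\<Prod>b\<in>Basis. ?w (x \<bullet> b)) = inverse (\<Prod>b\<in>Basis. 1 + (x \<bullet> b)\<^sup>2)"
      by (simp add: prod_inversef[symmetric] o_def)
    ultimately show ?thesis
      by (simp only: divide_inverse[symmetric] pos_le_divide_eq mult.commute)
  qed
  show ?thesis
  proof (rule Bochner_Integration.integrable_bound)
    show "integrable lborel (\<lambda>x::'a. 2 ^ ?d * (C0 + C1) * (\<Prod>b\<in>Basis. ?w (x \<bullet> b)))"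
      by (intro integrable_mult_right iw)
    show "AE x in lborel. norm (f x) \<le> norm (2 ^ ?d * (C0 + C1) * (\<Prod>b\<in>Basis. ?w (x \<bullet> b)))"
      using bound by (auto intro!: AE_I2 order_trans[OF bound] abs_ge_self)
  qed simp
qed

lemma integrable_schwartz:
  fixes h :: "real^3 \<Rightarrow> complex"
  assumes h: "schwartz h"
  shows "integrable lborel h"
proof (rule integrable_rapidly_decreasing)
  show "h \<in> borel_measurable borel"
    using h C_infinity_continuous by (auto simp: schwartz_def intro!: borel_measurable_continuous_onI)
  have "\<forall>n vs. set vs \<subseteq> Basis \<longrightarrow> bounded (range (\<lambda>x. norm x ^ n *\<^sub>R iter_partial vs h x))"
    using h by (simp add: schwartz_def)
  from this[rule_format, of "[]"] show "bounded (range (\<lambda>x. norm x ^ n *\<^sub>R h x))" for n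
    by (simp add: iter_partial_def)
qed

text \<open>The real weights used below are the components of \<open>k\<close>, multiples of the frequency \<open>c |k|\<close>, and their
  combinations. The frequency is not smooth at the origin, so the products need not be Schwartz functions;
  but they are continuous and still decay rapidly, which is all that Fourier uniqueness requires.\<close>

lemma schwartz_weighted:
  fixes h :: "real^3 \<Rightarrow> complex" and \<beta> :: "real^3 \<Rightarrow> real"
  assumes h: "schwartz h" and cont: "continuous_on UNIV \<beta>" and le: "\<And>k. \<bar>\<beta> k\<bar> \<le> C * norm k"
  shows integrable_schwartz_weighted: "integrable lborel (\<lambda>k. of_real (\<beta> k) * h k)"
    and bounded_schwartz_weighted: "bounded (range (\<lambda>k. of_real (\<beta> k) * h k))"
    and continuous_schwartz_weighted: "continuous_on UNIV (\<lambda>k. of_real (\<beta> k) * h k)"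
proof -
  have ch: "continuous_on UNIV h"
    using h C_infinity_continuous by (auto simp: schwartz_def)
  have "\<forall>n vs. set vs \<subseteq> Basis \<longrightarrow> bounded (range (\<lambda>x. norm x ^ n *\<^sub>R iter_partial vs h x))"
    using h by (simp add: schwartz_def)
  from this[rule_format, of "[]"] have bh: "bounded (range (\<lambda>x. norm x ^ n *\<^sub>R h x))" for n
    by (simp add: iter_partial_def)
  show c: "continuous_on UNIV (\<lambda>k. of_real (\<beta> k) * h k)"
    by (intro continuous_intros cont ch)
  have b: "bounded (range (\<lambda>k. norm k ^ n *\<^sub>R (of_real (\<beta> k) * h k)))" for n
  proof -
    obtain B where B: "\<And>k. norm k ^ Suc n * norm (h k) \<le> B"
      using bh[of "Suc n"] by (auto simp: bounded_iff)
    have "norm (norm k ^ n *\<^sub>R (of_real (\<beta> k) * h k)) \<le> \<bar>C\<bar> * B" for k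
    proof -
      have "\<bar>\<beta> k\<bar> \<le> \<bar>C\<bar> * norm k"
        by (rule order_trans[OF le]) (simp add: mult_right_mono)
      then have "norm k ^ n * (\<bar>\<beta> k\<bar> * norm (h k)) \<le> norm k ^ n * ((\<bar>C\<bar> * norm k) * norm (h k))"
        by (intro mult_left_mono mult_right_mono) auto
      also have "\<dots> = \<bar>C\<bar> * (norm k ^ Suc n * norm (h k))" by simp
      also have "\<dots> \<le> \<bar>C\<bar> * B" by (intro mult_left_mono B) simp
      finally show ?thesis by (simp add: norm_mult)
    qed
    then show ?thesis by (auto simp: bounded_iff)
  qed
  show "integrable lborel (\<lambda>k. of_real (\<beta> k) * h k)"
    by (rule integrable_rapidly_decreasing[OF borel_measurable_continuous_onI[OF c] b])
  show "bounded (range (\<lambda>k. of_real (\<beta> k) * h k))"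
    using b[of 0] by simp
qed

lemma has_vector_derivative_iff_quotient:
  fixes f :: "real \<Rightarrow> 'b::real_normed_vector"
  shows "(f has_vector_derivative D) (at 0) \<longleftrightarrow> ((\<lambda>s. (f s - f 0) /\<^sub>R s) \<longlongrightarrow> D) (at 0)"
proof -
  have "(f has_vector_derivative D) (at 0) \<longleftrightarrow>
      ((\<lambda>s. norm (f s - f 0 - s *\<^sub>R D) / norm s) \<longlongrightarrow> 0) (at 0)"
    by (simp add: has_vector_derivative_def has_derivative_at bounded_linear_scaleR_left)
  also have "\<dots> \<longleftrightarrow> ((\<lambda>s. norm ((f s - f 0) /\<^sub>R s - D)) \<longlongrightarrow> 0) (at 0)"
  proof (rule filterlim_cong[OF refl refl])
    show "\<forall>\<^sub>F s in at 0. norm (f s - f 0 - s *\<^sub>R D) / norm s = norm ((f s - f 0) /\<^sub>R s - D)"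
    proof (rule eventually_at_filter[THEN iffD2], intro always_eventually allI impI)
      fix s :: real assume "s \<noteq> 0"
      then have "(f s - f 0) /\<^sub>R s - D = (f s - f 0 - s *\<^sub>R D) /\<^sub>R s"
        by (simp add: scaleR_diff_right)
      then show "norm (f s - f 0 - s *\<^sub>R D) / norm s = norm ((f s - f 0) /\<^sub>R s - D)"
        by (simp add: divide_inverse mult.commute)
    qed
  qed
  also have "\<dots> \<longleftrightarrow> ((\<lambda>s. (f s - f 0) /\<^sub>R s) \<longlongrightarrow> D) (at 0)"
    by (simp only: tendsto_norm_zero_iff LIM_zero_iff)
  finally show ?thesis .
qed

text \<open>Differentiation under the integral sign: by \<open>|e\<^bsup>i\<theta>\<^esup> - 1| \<le> |\<theta>|\<close> all difference quotients of the integrand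
  are dominated by \<open>|\<beta> h|\<close>.\<close>

lemma has_vector_derivative_oscillatory_integral:
  fixes h :: "'a \<Rightarrow> complex" and \<alpha> \<beta> :: "'a \<Rightarrow> real"
  assumes h: "integrable M h" and bh: "integrable M (\<lambda>k. of_real (\<beta> k) * h k)"
    and [measurable]: "\<alpha> \<in> borel_measurable M" "\<beta> \<in> borel_measurable M"
  shows "((\<lambda>s. LINT k|M. h k * exp (\<i> * of_real (\<alpha> k + s * \<beta> k))) has_vector_derivative
          (LINT k|M. \<i> * of_real (\<beta> k) * h k * exp (\<i> * of_real (\<alpha> k)))) (at 0)"
proof -
  have [measurable]: "h \<in> borel_measurable M" using h by simp
  let ?E = "\<lambda>s k. h k * exp (\<i> * of_real (\<alpha> k + s * \<beta> k))"
  let ?\<Phi> = "\<lambda>s. LINT k|M. ?E s k"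
  have intE: "integrable M (?E s)" for s
    by (rule Bochner_Integration.integrable_bound[OF h]) (auto simp: norm_mult)
  have "((\<lambda>s. (?\<Phi> s - ?\<Phi> 0) /\<^sub>R s) \<longlongrightarrow> (LINT k|M. \<i> * of_real (\<beta> k) * h k * exp (\<i> * of_real (\<alpha> k)))) (at 0)"
    unfolding tendsto_at_iff_sequentially
  proof (intro allI impI)
    fix X :: "nat \<Rightarrow> real"
    assume X: "\<forall>n. X n \<in> UNIV - {0}" and X0: "X \<longlonglongrightarrow> 0"
    have "(\<lambda>n. LINT k|M. (?E (X n) k - ?E 0 k) /\<^sub>R X n) \<longlonglongrightarrow>
       (LINT k|M. \<i> * of_real (\<beta> k) * h k * exp (\<i> * of_real (\<alpha> k)))"
    proof (rule integral_dominated_convergence[where w="\<lambda>k. norm (of_real (\<beta> k) * h k)"])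
      show "integrable M (\<lambda>k. norm (of_real (\<beta> k) * h k))" using bh by simp
      have "((\<lambda>s. (?E s k - ?E 0 k) /\<^sub>R s) \<longlongrightarrow> \<i> * of_real (\<beta> k) * h k * exp (\<i> * of_real (\<alpha> k))) (at 0)" for k
      proof -
        have "((\<lambda>s. ?E s k) has_vector_derivative \<i> * of_real (\<beta> k) * h k * exp (\<i> * of_real (\<alpha> k))) (at 0)"
          by (auto intro!: derivative_eq_intros has_vector_derivative_real_field simp: o_def)
        then show ?thesis
          by (simp only: has_vector_derivative_iff_quotient)
      qed
      then show "AE k in M. (\<lambda>n. (?E (X n) k - ?E 0 k) /\<^sub>R X n) \<longlonglongrightarrow> \<i> * of_real (\<beta> k) * h k * exp (\<i> * of_real (\<alpha> k))"
        using X X0 by (auto simp: tendsto_at_iff_sequentially o_def)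
      show "AE k in M. norm ((?E (X n) k - ?E 0 k) /\<^sub>R X n) \<le> norm (of_real (\<beta> k) * h k)" for n
      proof (rule AE_I2)
        fix k
        have "norm (?E (X n) k - ?E 0 k) = norm (h k) * norm (exp (\<i> * of_real (X n * \<beta> k)) - 1)"
        proof -
          have "?E (X n) k - ?E 0 k = h k * exp (\<i> * of_real (\<alpha> k)) * (exp (\<i> * of_real (X n * \<beta> k)) - 1)"
            by (simp add: algebra_simps exp_add)
          then show ?thesis by (simp add: norm_mult)
        qed
        also have "\<dots> \<le> norm (h k) * \<bar>X n * \<beta> k\<bar>"
          using iexp_approx1[of "X n * \<beta> k" 0] by (intro mult_left_mono) auto
        finally have le: "norm (?E (X n) k - ?E 0 k) \<le> \<bar>X n\<bar> * norm (of_real (\<beta> k) * h k)"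
          by (simp only: norm_mult norm_of_real abs_mult mult_ac)
        have "norm ((?E (X n) k - ?E 0 k) /\<^sub>R X n) = norm (?E (X n) k - ?E 0 k) / \<bar>X n\<bar>"
          by (simp only: norm_scaleR abs_inverse divide_inverse mult.commute)
        also have "\<dots> \<le> norm (of_real (\<beta> k) * h k)"
          using X le by (subst pos_divide_le_eq) (auto simp only: mult.commute zero_less_abs_iff)
        finally show "norm ((?E (X n) k - ?E 0 k) /\<^sub>R X n) \<le> norm (of_real (\<beta> k) * h k)" .
      qed
    qed auto
    moreover have "(LINT k|M. (?E s k - ?E 0 k) /\<^sub>R s) = (?\<Phi> s - ?\<Phi> 0) /\<^sub>R s" for s
      using Bochner_Integration.integral_diff[OF intE[of s] intE[of 0]]
      by (simp only: integral_scaleR_right)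
    ultimately show "((\<lambda>s. (?\<Phi> s - ?\<Phi> 0) /\<^sub>R s) \<circ> X) \<longlonglongrightarrow> (LINT k|M. \<i> * of_real (\<beta> k) * h k * exp (\<i> * of_real (\<alpha> k)))"
      by (simp only: o_def)
  qed
  then show ?thesis
    by (simp only: has_vector_derivative_iff_quotient)
qed

lemma integral_vec_nth:
  fixes v :: "'a \<Rightarrow> ('b::euclidean_space)^'n"
  assumes int: "\<And>i. integrable M (\<lambda>k. v k $ i)"
  shows "integral\<^sup>L M v $ i = (LINT k|M. v k $ i)"
proof -
  have lin: "bounded_linear (axis j :: 'b \<Rightarrow> 'b^'n)" for j
    unfolding linear_conv_bounded_linear[symmetric]
    by (rule linearI) (auto simp: vec_eq_iff axis_def)
  have "integrable M (\<lambda>k. \<Sum>j\<in>UNIV. axis j (v k $ j))"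
    by (intro Bochner_Integration.integrable_sum integrable_bounded_linear[OF lin] int)
  moreover have "(\<lambda>k. \<Sum>j\<in>UNIV. axis j (v k $ j)) = v"
    by (simp add: fun_eq_iff vec_eq_iff axis_def)
  ultimately have "integrable M v" by simp
  then show ?thesis
    using integral_bounded_linear[OF bounded_linear_vec_nth] by metis
qed

section \<open>Wave packets\<close>

text \<open>The superposition of the plane waves \<open>e\<^bsup>i(k \<bullet> x + \<phi>(k) t)\<^esup>\<close> with amplitude \<open>h\<close>. The dispersion relation
  \<open>\<phi>\<close> is a parameter so that \<open>\<phi> = \<omega>\<close> and \<open>\<phi> = -\<omega>\<close> are treated together.\<close>

definition wave_packet :: "(real^3 \<Rightarrow> real) \<Rightarrow> (real^3 \<Rightarrow> complex) \<Rightarrow> spacetime \<Rightarrow> complex" where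
  "wave_packet \<phi> h p = (LINT k|lborel. h k * exp (\<i> * of_real (k \<bullet> fst p + \<phi> k * snd p)))"

lemma integrable_wave_packet:
  assumes cont_\<phi>: "continuous_on UNIV \<phi>" and h: "integrable lborel h"
  shows "integrable lborel (\<lambda>k. h k * exp (\<i> * of_real (k \<bullet> fst p + \<phi> k * snd p)))"
proof (rule Bochner_Integration.integrable_bound[OF h])
  have [measurable]: "\<phi> \<in> borel_measurable borel"
    using cont_\<phi> by (rule borel_measurable_continuous_onI)
  have [measurable]: "h \<in> borel_measurable borel" using h by simp
  show "(\<lambda>k. h k * exp (\<i> * of_real (k \<bullet> fst p + \<phi> k * snd p))) \<in> borel_measurable lborel"
    by measurable
qed (simp add: norm_mult)

lemma wave_packet_add:
  assumes "continuous_on UNIV \<phi>" and "integrable lborel a" "integrable lborel b"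
  shows "wave_packet \<phi> (\<lambda>k. a k + b k) p = wave_packet \<phi> a p + wave_packet \<phi> b p"
  unfolding wave_packet_def distrib_right
  by (intro Bochner_Integration.integral_add integrable_wave_packet assms)

lemma wave_packet_cmult: "wave_packet \<phi> (\<lambda>k. z * a k) p = z * wave_packet \<phi> a p"
  by (simp add: wave_packet_def mult.assoc)

lemma wave_packet_line_derivative:
  assumes cont_\<phi>: "continuous_on UNIV \<phi>" and h: "integrable lborel h"
    and h': "integrable lborel (\<lambda>k. of_real (k \<bullet> fst v + \<phi> k * snd v) * h k)"
  shows "((\<lambda>s. wave_packet \<phi> h (p + s *\<^sub>R v)) has_vector_derivative
      wave_packet \<phi> (\<lambda>k. \<i> * of_real (k \<bullet> fst v + \<phi> k * snd v) * h k) p) (at 0)"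
proof -
  have [measurable]: "\<phi> \<in> borel_measurable borel"
    using cont_\<phi> by (rule borel_measurable_continuous_onI)
  show ?thesis
    using has_vector_derivative_oscillatory_integral[OF h h', of "\<lambda>k. k \<bullet> fst p + \<phi> k * snd p"]
    by (simp add: wave_packet_def algebra_simps)
qed

text \<open>At a fixed time the sum of the two packets is the Fourier transform of a single function, which
  therefore vanishes. Evaluating at two times at which the phase factors are linearly independent
  separates the amplitudes.\<close>

lemma two_wave_packets_uniqueness:
  fixes \<omega> :: "real^3 \<Rightarrow> real"
  assumes cont_\<omega>: "continuous_on UNIV \<omega>" and "\<omega> k \<noteq> 0"
    and a: "continuous_on UNIV a" "bounded (range a)" "integrable lborel a"
    and b: "continuous_on UNIV b" "bounded (range b)" "integrable lborel b"
    and zero: "\<And>p. wave_packet (\<lambda>k. - \<omega> k) a p + wave_packet \<omega> b p = 0"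
  shows "a k = 0" and "b k = 0"
proof -
  have m\<omega>: "continuous_on UNIV (\<lambda>k. - \<omega> k)" using cont_\<omega> by (intro continuous_intros)
  have at_time: "a k * exp (\<i> * of_real (- \<omega> k * t)) + b k * exp (\<i> * of_real (\<omega> k * t)) = 0" for t
  proof -
    let ?h = "\<lambda>k. a k * exp (\<i> * of_real (- \<omega> k * t)) + b k * exp (\<i> * of_real (\<omega> k * t))"
    obtain B1 B2 where B: "\<And>k. norm (a k) \<le> B1" "\<And>k. norm (b k) \<le> B2"
      using a(2) b(2) by (auto simp: bounded_iff)
    show ?thesis
    proof (rule fourier_uniqueness[of ?h "B1 + B2"])
      show "continuous_on UNIV ?h"
        by (intro continuous_intros a b cont_\<omega>)
      show "norm (?h k) \<le> B1 + B2" for k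
        by (rule order_trans[OF norm_triangle_ineq add_mono]) (use B in \<open>simp_all add: norm_mult\<close>)
      show "integrable lborel ?h"
        using Bochner_Integration.integrable_add[OF integrable_wave_packet[OF m\<omega> a(3), of "(0, t)"]
            integrable_wave_packet[OF cont_\<omega> b(3), of "(0, t)"]]
        by simp
      fix x :: "real^3"
      have "(LINT k|lborel. ?h k * exp (\<i> * of_real (k \<bullet> x)))
        = (LINT k|lborel. a k * exp (\<i> * of_real (k \<bullet> x + - \<omega> k * t))
             + b k * exp (\<i> * of_real (k \<bullet> x + \<omega> k * t)))"
        by (rule Bochner_Integration.integral_cong[OF refl])
           (simp only: of_real_add distrib_left distrib_right exp_add mult_ac)
      also have "\<dots> = wave_packet (\<lambda>k. - \<omega> k) a (x, t) + wave_packet \<omega> b (x, t)"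
        unfolding wave_packet_def fst_conv snd_conv
        by (rule Bochner_Integration.integral_add)
           (use integrable_wave_packet[OF m\<omega> a(3), of "(x, t)"]
             integrable_wave_packet[OF cont_\<omega> b(3), of "(x, t)"] in simp_all)
      finally show "(LINT k|lborel. ?h k * exp (\<i> * of_real (k \<bullet> x))) = 0"
        using zero by simp
    qed
  qed
  \<comment> \<open>At \<open>t = 0\<close> the phase factors are \<open>1, 1\<close>; at a quarter period they are \<open>-i, i\<close>.\<close>
  have "a k + b k = 0" using at_time[of 0] by simp
  moreover have "a k * exp (\<i> * of_real (- (pi / 2))) + b k * exp (\<i> * of_real (pi / 2)) = 0"
    using at_time[of "pi / (2 * \<omega> k)"] \<open>\<omega> k \<noteq> 0\<close> by simp
  then have "\<i> * (b k - a k) = 0"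
    by (simp add: exp_eq_polar cis_conv_exp[symmetric] cis_minus_pi_half algebra_simps
        flip: of_real_minus)
  ultimately show "a k = 0" "b k = 0" by auto
qed

section \<open>The amplitudes of coupled wave packets\<close>

text \<open>Differentiation multiplies an amplitude by \<open>i k\<^sub>i\<close> in space and by \<open>\<mp> i \<omega>\<close> in time, so the coupling says that
  the packets with amplitudes \<open>k\<^sub>i f - \<omega> F / c\<^sup>2\<close> and \<open>k\<^sub>i g + \<omega> G / c\<^sup>2\<close> cancel. Here \<open>j\<close> stands for one
  component of the current.\<close>

lemma wave_packet_amplitudes:
  fixes \<rho> :: "spacetime \<Rightarrow> real" and j :: "spacetime \<Rightarrow> real"
  assumes c: "c > 0" and smooth_\<rho>: "C_infinity \<rho>" and smooth_j: "C_infinity j"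
    and momentum: "\<And>p. space_deriv i \<rho> p + 1 / c\<^sup>2 * time_deriv j p = 0"
    and schwartz: "schwartz f" "schwartz g" "schwartz F" "schwartz G"
    and \<rho>_eq: "\<And>p. complex_of_real (\<rho> p) =
      wave_packet (\<lambda>k. - angular_freq c k) f p + wave_packet (angular_freq c) g p"
    and j_eq: "\<And>p. complex_of_real (j p) =
      wave_packet (\<lambda>k. - angular_freq c k) F p + wave_packet (angular_freq c) G p"
    and k: "k \<noteq> 0"
  shows "F k = of_real (c * k $ i / norm k) * f k"
    and "G k = - (of_real (c * k $ i / norm k) * g k)"
proof -
  let ?\<omega> = "angular_freq c"
  note line = frechet_has_real_derivative_line[OF C_infinity_differentiable]
  have c\<omega>: "continuous_on UNIV ?\<omega>"
    unfolding angular_freq_def[abs_def] by (intro continuous_intros)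
  have cm\<omega>: "continuous_on UNIV (\<lambda>k. - ?\<omega> k)"
    using c\<omega> by (intro continuous_intros)
  have derivative: "complex_of_real (dir_deriv v u p)
      = wave_packet (\<lambda>k. - ?\<omega> k) (\<lambda>k. \<i> * of_real (k \<bullet> fst v + - ?\<omega> k * snd v) * a k) p
        + wave_packet ?\<omega> (\<lambda>k. \<i> * of_real (k \<bullet> fst v + ?\<omega> k * snd v) * b k) p"
    if u: "C_infinity u" and a: "schwartz a" and b: "schwartz b"
      and eq: "\<And>p. complex_of_real (u p) = wave_packet (\<lambda>k. - ?\<omega> k) a p + wave_packet ?\<omega> b p"
    for u :: "spacetime \<Rightarrow> real" and a b v p
  proof -
    have bound: "\<bar>k \<bullet> fst v + \<sigma> * ?\<omega> k * snd v\<bar> \<le> (norm (fst v) + c * \<bar>snd v\<bar>) * norm k"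
      if "\<bar>\<sigma>\<bar> = 1" for k and \<sigma> :: real
    proof -
      have "\<bar>k \<bullet> fst v + \<sigma> * ?\<omega> k * snd v\<bar> \<le> \<bar>k \<bullet> fst v\<bar> + \<bar>\<sigma> * ?\<omega> k * snd v\<bar>"
        by (rule abs_triangle_ineq)
      also have "\<dots> \<le> norm k * norm (fst v) + \<bar>\<sigma> * ?\<omega> k * snd v\<bar>"
        by (intro add_right_mono Cauchy_Schwarz_ineq2)
      finally show ?thesis
        using c that by (simp add: abs_mult angular_freq_def algebra_simps)
    qed
    have ia: "integrable lborel (\<lambda>k. of_real (k \<bullet> fst v + - ?\<omega> k * snd v) * a k)"
      by (rule integrable_schwartz_weighted[OF a])
         (use bound[of "-1"] in \<open>auto intro!: continuous_intros c\<omega>\<close>)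
    have ib: "integrable lborel (\<lambda>k. of_real (k \<bullet> fst v + ?\<omega> k * snd v) * b k)"
      by (rule integrable_schwartz_weighted[OF b])
         (use bound[of "1"] in \<open>auto intro!: continuous_intros c\<omega>\<close>)
    have "((\<lambda>s. complex_of_real (u (p + s *\<^sub>R v))) has_vector_derivative
      wave_packet (\<lambda>k. - ?\<omega> k) (\<lambda>k. \<i> * of_real (k \<bullet> fst v + - ?\<omega> k * snd v) * a k) p
        + wave_packet ?\<omega> (\<lambda>k. \<i> * of_real (k \<bullet> fst v + ?\<omega> k * snd v) * b k) p) (at 0)"
      unfolding eq
      by (intro has_vector_derivative_add wave_packet_line_derivative[OF cm\<omega> integrable_schwartz[OF a] ia]
          wave_packet_line_derivative[OF c\<omega> integrable_schwartz[OF b] ib])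
    moreover have "((\<lambda>s. complex_of_real (u (p + s *\<^sub>R v))) has_vector_derivative
        complex_of_real (dir_deriv v u p)) (at 0)"
      using line[OF u, of p v]
      by (intro bounded_linear.has_vector_derivative[OF bounded_linear_of_real])
         (simp add: has_real_derivative_iff_has_vector_derivative)
    ultimately show ?thesis
      by (rule vector_derivative_unique_at[rotated])
  qed
  \<comment> \<open>The amplitudes that have to vanish, up to the factor \<open>i\<close>: \<open>\<sigma> = -1\<close> for \<open>f, F\<close> and \<open>\<sigma> = 1\<close> for \<open>g, G\<close>.\<close>
  let ?a = "\<lambda>\<sigma> f F k. complex_of_real (k $ i) * f k + of_real (\<sigma> * ?\<omega> k / c\<^sup>2) * F k"
  have 1: "\<bar>k $ i\<bar> \<le> 1 * norm k" for k :: "real^3"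
    using component_le_norm_cart[of k i] by simp
  have 2: "\<bar>\<sigma> * ?\<omega> k / c\<^sup>2\<bar> \<le> (\<bar>\<sigma>\<bar> / c) * norm k" for k :: "real^3" and \<sigma> :: real
    using c by (simp add: angular_freq_def abs_mult power2_eq_square)
  have c1: "continuous_on UNIV (\<lambda>k::real^3. k $ i)"
    and c2: "continuous_on UNIV (\<lambda>k. \<sigma> * ?\<omega> k / c\<^sup>2)" for \<sigma> :: real
    using c by (auto intro!: continuous_intros c\<omega>)
  note terms = integrable_schwartz_weighted[OF _ c1 1] integrable_schwartz_weighted[OF _ c2 2]
  have amp: "continuous_on UNIV (?a \<sigma> f F)" "bounded (range (?a \<sigma> f F))" "integrable lborel (?a \<sigma> f F)"
    if "schwartz f" "schwartz F" for f F and \<sigma> :: real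
  proof -
    note w1 = schwartz_weighted[OF that(1) c1 1] and w2 = schwartz_weighted[OF that(2) c2 2]
    show "continuous_on UNIV (?a \<sigma> f F)" by (intro continuous_on_add w1 w2)
    show "integrable lborel (?a \<sigma> f F)" by (intro Bochner_Integration.integrable_add w1 w2)
    show "bounded (range (?a \<sigma> f F))" by (intro bounded_plus_comp w1 w2)
  qed
  have zero: "wave_packet (\<lambda>k. - ?\<omega> k) (?a (-1) f F) p + wave_packet ?\<omega> (?a 1 g G) p = 0" for p
  proof -
    let ?U = "\<lambda>\<phi> h. wave_packet \<phi> (\<lambda>k. of_real (k $ i) * h k) p"
    let ?V = "\<lambda>\<phi> h. wave_packet \<phi> (\<lambda>k. of_real (?\<omega> k) * h k) p"
    have split: "wave_packet \<phi> (?a \<sigma> h H) p = ?U \<phi> h + of_real (\<sigma> / c\<^sup>2) * ?V \<phi> H"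
      if "continuous_on UNIV \<phi>" "schwartz h" "schwartz H" for \<phi> \<sigma> h H
    proof -
      have "wave_packet \<phi> (?a \<sigma> h H) p = ?U \<phi> h + wave_packet \<phi> (\<lambda>k. of_real (\<sigma> * ?\<omega> k / c\<^sup>2) * H k) p"
        by (intro wave_packet_add that terms)
      moreover have "(\<lambda>k. of_real (\<sigma> * ?\<omega> k / c\<^sup>2) * H k) = (\<lambda>k. of_real (\<sigma> / c\<^sup>2) * (of_real (?\<omega> k) * H k))"
        by (simp add: fun_eq_iff)
      ultimately show ?thesis by (simp only: wave_packet_cmult)
    qed
    have \<rho>': "complex_of_real (space_deriv i \<rho> p) = \<i> * (?U (\<lambda>k. - ?\<omega> k) f + ?U ?\<omega> g)"
      using derivative[OF smooth_\<rho> schwartz(1,2) \<rho>_eq, of "(axis i 1, 0)" p]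
      by (simp add: space_deriv_def inner_axis mult.assoc wave_packet_cmult distrib_left)
    have V: "wave_packet \<phi> (\<lambda>k. \<i> * of_real (k \<bullet> fst (0::real^3, 1::real) + \<sigma> * ?\<omega> k * snd (0::real^3, 1::real)) * H k) p
        = \<i> * of_real \<sigma> * ?V \<phi> H" for \<phi> \<sigma> H
      unfolding wave_packet_cmult[symmetric] by (simp add: mult_ac)
    have j': "complex_of_real (time_deriv j p) = \<i> * (?V ?\<omega> G - ?V (\<lambda>k. - ?\<omega> k) F)"
      using derivative[OF smooth_j schwartz(3,4) j_eq, of "(0, 1)" p]
        V[of "\<lambda>k. - ?\<omega> k" "- 1" F] V[of ?\<omega> 1 G]
      unfolding time_deriv_def by (simp add: right_diff_distrib)
    have "complex_of_real (space_deriv i \<rho> p + 1 / c\<^sup>2 * time_deriv j p) = 0"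
      by (simp only: momentum of_real_0)
    then have "\<i> * ((?U (\<lambda>k. - ?\<omega> k) f + ?U ?\<omega> g)
        + of_real (1 / c\<^sup>2) * (?V ?\<omega> G - ?V (\<lambda>k. - ?\<omega> k) F)) = 0"
      unfolding of_real_add of_real_mult \<rho>' j' by (simp only: distrib_left mult.left_commute)
    then have "(?U (\<lambda>k. - ?\<omega> k) f + ?U ?\<omega> g)
        + of_real (1 / c\<^sup>2) * (?V ?\<omega> G - ?V (\<lambda>k. - ?\<omega> k) F) = 0"
      by (simp only: mult_eq_0_iff complex_i_not_zero simp_thms)
    then show ?thesis
      unfolding split[OF cm\<omega> schwartz(1,3)] split[OF c\<omega> schwartz(2,4)]
      by (simp add: right_diff_distrib algebra_simps)
  qed
  have "?\<omega> k \<noteq> 0" using c k by (simp add: angular_freq_def)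
  note amplitudes_0 = two_wave_packets_uniqueness[OF c\<omega> this
      amp[OF schwartz(1,3)] amp[OF schwartz(2,4)] zero]
  show "F k = of_real (c * k $ i / norm k) * f k"
    using amplitudes_0(1) c k by (simp add: angular_freq_def field_simps power2_eq_square)
  show "G k = - (of_real (c * k $ i / norm k) * g k)"
    using amplitudes_0(2) c k
    by (simp add: angular_freq_def field_simps power2_eq_square eq_neg_iff_add_eq_0)
qed

lemma cvec_projection:
  fixes k :: "real^'n" and V :: "complex^'n"
  assumes k: "k \<noteq> 0" and c: "c \<noteq> 0" and V: "\<And>i. V $ i = of_real (c * k $ i / norm k) * z"
  shows "V = (of_real c * z / of_real (norm k)) *s cvec k"
    and "z = bilin_dot (cvec k) V / of_real (c * norm k)"
proof -
  show "V = (of_real c * z / of_real (norm k)) *s cvec k"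
    by (simp add: vec_eq_iff V cvec_def mult_ac)
  have "bilin_dot (cvec k) V = of_real (c / norm k) * z * of_real (\<Sum>i\<in>UNIV. k $ i * k $ i)"
    by (simp add: bilin_dot_def cvec_def V sum_distrib_left mult_ac)
  also have "(\<Sum>i\<in>UNIV. k $ i * k $ i) = norm k * norm k"
    using power2_norm_eq_inner[of k] unfolding inner_vec_def power2_eq_square by simp
  finally show "z = bilin_dot (cvec k) V / of_real (c * norm k)"
    using k c by (simp add: field_simps)
qed

section \<open>Backward uniqueness for the acoustic system\<close>

text \<open>All translates of \<open>g\<close> have the same integral, and the derivative of this constant in the
  direction \<open>v\<close> is the integral of the directional derivative. This replaces integration by parts.\<close>

lemma has_integral_directional_derivative_0:
  fixes g g' :: "'a::euclidean_space \<Rightarrow> real"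
  assumes deriv: "\<And>p. ((\<lambda>s. g (p + s *\<^sub>R v)) has_real_derivative g' p) (at 0)"
    and contg: "continuous_on UNIV g" and contg': "continuous_on UNIV g'"
    and supp: "\<And>p. p \<notin> ball 0 R \<Longrightarrow> g p = 0"
  shows "(g' has_integral 0) UNIV"
proof -
  \<comment> \<open>Enlarging the support by \<open>norm v\<close> makes room for all translates with \<open>\<bar>s\<bar> \<le> 1\<close>, so that one box serves
    for all of them.\<close>
  define r where "r = R + norm v"
  have out: "g (p + s *\<^sub>R v) = 0" if "norm p \<ge> r" "\<bar>s\<bar> \<le> 1" for p s
  proof -
    have "norm p \<le> norm (p + s *\<^sub>R v) + norm (s *\<^sub>R v)"
      using norm_triangle_ineq4[of "p + s *\<^sub>R v" "s *\<^sub>R v"] by simp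
    moreover have "norm (s *\<^sub>R v) \<le> norm v"
      using that(2) by (simp add: mult_left_le_one_le)
    ultimately show ?thesis
      using that(1) by (intro supp) (simp add: r_def)
  qed
  obtain a b :: 'a where ab: "cball 0 r \<subseteq> cbox a b"
    using bounded_subset_cbox_symmetric[OF bounded_cball] by metis
  have out_box: "g (p + s *\<^sub>R v) = 0" if "p \<notin> cbox a b" "\<bar>s\<bar> \<le> 1" for p s
  proof (rule out)
    have "p \<notin> cball 0 r" using ab that(1) by blast
    then show "norm p \<ge> r" by simp
  qed fact
  have g'_out: "g' p = 0" if "p \<notin> cbox a b" for p
  proof -
    have "((\<lambda>s. g (p + s *\<^sub>R v)) has_real_derivative 0) (at 0)"
    proof (rule has_field_derivative_transform_within[of "\<lambda>_. 0" _ _ _ 1])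
      fix s :: real assume "dist s 0 < 1"
      then show "0 = g (p + s *\<^sub>R v)"
        using out_box[OF that, of s] by (simp add: dist_real_def)
    qed auto
    with deriv show ?thesis by (rule DERIV_unique)
  qed
  have line: "((\<lambda>s. g (p + s *\<^sub>R v)) has_real_derivative g' (p + s *\<^sub>R v)) (at s within U)" for p s U
    by (rule has_field_derivative_at_within[OF line_derivative_shift[OF deriv]])
  have int_s: "((\<lambda>p. g (p + s *\<^sub>R v)) has_integral integral UNIV g) (cbox a b)" if "\<bar>s\<bar> \<le> 1" for s
  proof -
    have restrict: "(g has_integral I) S \<longleftrightarrow> (g has_integral I) UNIV" if "\<And>p. p \<notin> S \<Longrightarrow> g p = 0" for S I
    proof -
      have "(\<lambda>p. if p \<in> S then g p else 0) = g" using that by auto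
      then show ?thesis by (metis has_integral_restrict_UNIV)
    qed
    have "g integrable_on cbox a b"
      by (intro integrable_continuous continuous_on_subset[OF contg]) auto
    moreover have "g p = 0" if "p \<notin> cbox a b" for p
      using out_box[OF that, of 0] by simp
    ultimately have "(g has_integral integral (cbox a b) g) UNIV"
      using restrict[of "cbox a b"] integrable_integral by blast
    moreover have "g p = 0" if "p \<notin> cbox (a + s *\<^sub>R v) (b + s *\<^sub>R v)" for p
    proof -
      have "p - s *\<^sub>R v \<notin> cbox a b"
        using that by (auto simp: mem_box algebra_simps)
      then show ?thesis using out_box[of "p - s *\<^sub>R v" s] \<open>\<bar>s\<bar> \<le> 1\<close> by simp
    qed
    ultimately have "(g has_integral integral UNIV g) (cbox (a + s *\<^sub>R v) (b + s *\<^sub>R v))"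
      using restrict[of "cbox (a + s *\<^sub>R v) (b + s *\<^sub>R v)"] by (simp add: integral_unique)
    then show ?thesis
      using has_integral_shift_cbox_iff[of g "s *\<^sub>R v" _ a b] by (simp add: o_def add.commute)
  qed
  have "((\<lambda>s. integral (cbox a b) (\<lambda>p. g (p + s *\<^sub>R v))) has_real_derivative
          integral (cbox a b) (\<lambda>p. g' (p + 0 *\<^sub>R v))) (at 0 within {-1<..<1})"
  proof (rule leibniz_rule_field_derivative[OF line])
    show "(\<lambda>p. g (p + s *\<^sub>R v)) integrable_on cbox a b" if "s \<in> {-1<..<1}" for s
      using int_s[of s] that by (auto simp: has_integral_integrable_integral)
    show "continuous_on ({-1<..<1} \<times> cbox a b) (\<lambda>(s, p). g' (p + s *\<^sub>R v))"
      unfolding split_beta by (intro continuous_on_compose2[OF contg'] continuous_intros) auto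
  qed auto
  moreover have "((\<lambda>s. integral (cbox a b) (\<lambda>p. g (p + s *\<^sub>R v))) has_real_derivative 0) (at 0 within {-1<..<1})"
  proof (rule has_field_derivative_transform_within[of "\<lambda>_. integral UNIV g" _ _ _ 1])
    fix s :: real assume "s \<in> {-1<..<1}"
    then show "integral UNIV g = integral (cbox a b) (\<lambda>p. g (p + s *\<^sub>R v))"
      using integral_unique[OF int_s[of s]] by (simp add: abs_le_iff)
  qed auto
  ultimately have "integral (cbox a b) g' = 0"
    by (auto simp: at_within_open[of _ "{-1<..<1}"] dest: DERIV_unique)
  moreover have "g' integrable_on cbox a b"
    by (intro integrable_continuous continuous_on_subset[OF contg']) auto
  ultimately have "(g' has_integral 0) (cbox a b)"
    by (metis integrable_integral)
  then show ?thesis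
    by (rule has_integral_on_superset) (use g'_out in auto)
qed

lemma continuous_nonneg_integral_0:
  fixes f :: "'a::euclidean_space \<Rightarrow> real"
  assumes cont: "continuous_on UNIV f" and nonneg: "\<And>x. f x \<ge> 0"
    and int: "(f has_integral 0) UNIV"
  shows "f x = 0"
proof -
  let ?B = "cbox (x - One) (x + One)"
  have i: "f integrable_on ?B"
    by (intro integrable_continuous continuous_on_subset[OF cont]) auto
  have "integral ?B f \<le> integral UNIV f"
    using i int nonneg by (intro integral_subset_le) (auto simp: has_integral_integrable_integral)
  moreover have "integral ?B f \<ge> 0"
    using nonneg by (intro integral_nonneg i) auto
  ultimately have "integral ?B f = 0"
    using int by (simp add: integral_unique)
  then have "(f has_integral 0) ?B"
    using i by (metis integrable_integral)
  moreover have x: "x \<in> box (x - One) (x + One)"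
    by (simp add: mem_box algebra_simps)
  then have "x \<in> ?B" "box (x - One) (x + One) \<noteq> {}"
    using box_subset_cbox by blast+
  ultimately show ?thesis
    by (intro has_integral_0_cbox_imp_0[of "x - One" "x + One" f x] continuous_on_subset[OF cont] nonneg) auto
qed

text \<open>The weight in the energy argument is the square of a positive part; squaring makes it continuously
  differentiable across the boundary of its support.\<close>

lemma has_real_derivative_max_0_square:
  "((\<lambda>x::real. (max 0 x)\<^sup>2) has_real_derivative 2 * max 0 x) (at x)"
proof (cases "x = 0")
  case True
  have "((\<lambda>h::real. (max 0 h)\<^sup>2 / h) \<longlongrightarrow> 0) (at 0)"
  proof (rule Lim_null_comparison[of _ "\<lambda>h. \<bar>h\<bar>"])
    show "\<forall>\<^sub>F h::real in at 0. norm ((max 0 h)\<^sup>2 / h) \<le> \<bar>h\<bar>"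
      by (intro always_eventually allI) (auto simp: max_def power2_eq_square)
  qed (auto intro!: tendsto_eq_intros)
  then show ?thesis by (simp add: DERIV_def True)
next
  case False
  show ?thesis
  proof (cases "x > 0")
    case True
    have "((\<lambda>x. x\<^sup>2) has_real_derivative 2 * max 0 x) (at x)"
      using True by (auto intro!: derivative_eq_intros)
    then show ?thesis
      by (rule has_field_derivative_transform_within_open[of _ _ _ "{0<..}"]) (use True in auto)
  next
    case nonpos: False
    have "((\<lambda>x. 0) has_real_derivative 2 * max 0 x) (at x)"
      using nonpos by auto
    then show ?thesis
      by (rule has_field_derivative_transform_within_open[of _ _ _ "{..<0}"]) (use nonpos False in auto)
  qed
qed

text \<open>The weight is \<open>w = (max 0 \<psi>)\<^sup>2\<close> with \<open>\<psi> = c (t - t\<^sub>0) + 1 - sqrt (1 + |x - x\<^sub>0|\<^sup>2)\<close>, a smooth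
  substitute for the light cone with apex \<open>(x\<^sub>0, t\<^sub>0)\<close>. Its spatial gradient has norm less than one while
  its time derivative is \<open>c\<close>. Hence the divergence of the weighted current \<open>(w \<rho> J, w e)\<close>, which is
  \<open>2 max 0 \<psi> (c e - \<rho> J \<bullet> (x - x\<^sub>0) / sqrt (1 + |x - x\<^sub>0|\<^sup>2))\<close> by the conservation law, is nonnegative,
  because \<open>|\<rho> J| \<le> c e\<close>. The fields vanish for \<open>t > 0\<close> and the set where
  \<open>\<psi> > 0\<close> and \<open>t \<le> 0\<close> is bounded, so this divergence has integral zero and vanishes. On the axis
  \<open>x = x\<^sub>0\<close> it equals \<open>2 c\<^sup>2 (t - t\<^sub>0) e\<close> for \<open>t > t\<^sub>0\<close>, so the energy density is zero there.\<close>

lemma acoustic_backward_uniqueness: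
  fixes \<rho> :: "spacetime \<Rightarrow> real" and J :: "spacetime \<Rightarrow> real^3"
  assumes c: "c > 0"
    and smooth_\<rho>: "C_infinity \<rho>" and smooth_J: "\<And>i. C_infinity (\<lambda>p. J p $ i)"
    and mass: "\<And>p. time_deriv \<rho> p + divergence J p = 0"
    and momentum: "\<And>p i. space_deriv i \<rho> p + 1 / c\<^sup>2 * time_deriv (\<lambda>q. J q $ i) p = 0"
    and future: "\<And>x t. t > 0 \<Longrightarrow> \<rho> (x, t) = 0 \<and> J (x, t) = 0"
  shows "\<rho> p\<^sub>1 = 0 \<and> J p\<^sub>1 = 0"
proof -
  \<comment> \<open>The apex lies one time unit before the point under consideration, which is then on the axis.\<close>
  define x\<^sub>0 t\<^sub>0 where "x\<^sub>0 = fst p\<^sub>1" and "t\<^sub>0 = snd p\<^sub>1 - 1"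
  define y where "y p = fst p - x\<^sub>0" for p :: spacetime
  define S where "S p = sqrt (1 + y p \<bullet> y p)" for p
  define \<psi> where "\<psi> p = c * (snd p - t\<^sub>0) + 1 - S p" for p
  define w where "w p = (max 0 (\<psi> p))\<^sup>2" for p
  define e where "e p = ((\<rho> p)\<^sup>2 + (\<Sum>i\<in>UNIV. (J p $ i)\<^sup>2) / c\<^sup>2) / 2" for p
  \<comment> \<open>The time derivative of \<open>w e\<close> and the \<open>i\<close>-th spatial derivative of \<open>w \<rho> J\<^sub>i\<close>.\<close>
  define E' where "E' p = 2 * max 0 (\<psi> p) * c * e p
     + w p * (\<rho> p * time_deriv \<rho> p + (\<Sum>i\<in>UNIV. J p $ i * time_deriv (\<lambda>q. J q $ i) p) / c\<^sup>2)" for p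
  define X' where "X' i p = - 2 * max 0 (\<psi> p) * (y p $ i / S p) * (\<rho> p * J p $ i)
     + w p * (space_deriv i \<rho> p * J p $ i + \<rho> p * space_deriv i (\<lambda>q. J q $ i) p)" for i p
  have S1: "S p \<ge> 1" for p by (simp add: S_def)
  have Sy: "norm (y p) \<le> S p" for p
    by (auto simp: S_def norm_eq_sqrt_inner)
  note line = frechet_has_real_derivative_line[OF C_infinity_differentiable]
  have d\<psi>: "((\<lambda>s. \<psi> (p + s *\<^sub>R v)) has_real_derivative c * snd v - (y p \<bullet> fst v) / S p) (at 0)" for p v
  proof -
    have "1 + y p \<bullet> y p > 0" by (simp add: add_pos_nonneg)
    then have "((\<lambda>s. c * (snd p + s * snd v - t\<^sub>0) + 1
         - sqrt (1 + (y p \<bullet> y p + 2 * s * (y p \<bullet> fst v) + s\<^sup>2 * (fst v \<bullet> fst v))))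
       has_real_derivative c * snd v - (y p \<bullet> fst v) / S p) (at 0)"
      by (auto intro!: derivative_eq_intros simp: S_def field_simps)
    moreover have "y (p + s *\<^sub>R v) \<bullet> y (p + s *\<^sub>R v)
       = y p \<bullet> y p + 2 * s * (y p \<bullet> fst v) + s\<^sup>2 * (fst v \<bullet> fst v)" for s
      by (simp add: y_def algebra_simps inner_commute power2_eq_square)
    ultimately show ?thesis
      by (simp add: \<psi>_def S_def)
  qed
  have dw: "((\<lambda>s. w (p + s *\<^sub>R v)) has_real_derivative
      2 * max 0 (\<psi> p) * (c * snd v - (y p \<bullet> fst v) / S p)) (at 0)" for p v
    using DERIV_chain2[OF has_real_derivative_max_0_square, OF d\<psi>, of p v] by (simp add: w_def)
  have d\<rho>: "((\<lambda>s. \<rho> (p + s *\<^sub>R v)) has_real_derivative dir_deriv v \<rho> p) (at 0)" for p v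
    by (rule line[OF smooth_\<rho>])
  have dJ: "((\<lambda>s. J (p + s *\<^sub>R v) $ i) has_real_derivative dir_deriv v (\<lambda>q. J q $ i) p) (at 0)" for p v i
    by (rule line[OF smooth_J])
  have de: "((\<lambda>s. e (p + s *\<^sub>R v)) has_real_derivative
      \<rho> p * dir_deriv v \<rho> p + (\<Sum>i\<in>UNIV. J p $ i * dir_deriv v (\<lambda>q. J q $ i) p) / c\<^sup>2) (at 0)" for p v
  proof -
    have "((\<lambda>s. (J (p + s *\<^sub>R v) $ i)\<^sup>2) has_real_derivative
        2 * (J p $ i * dir_deriv v (\<lambda>q. J q $ i) p)) (at 0)" for i
      using DERIV_power[OF dJ[of p v i], of 2] by (simp add: mult_ac)
    then have "((\<lambda>s. \<Sum>i\<in>UNIV. (J (p + s *\<^sub>R v) $ i)\<^sup>2) has_real_derivative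
        (\<Sum>i\<in>UNIV. 2 * (J p $ i * dir_deriv v (\<lambda>q. J q $ i) p))) (at 0)"
      by (rule DERIV_sum)
    from DERIV_cdivide[OF this, of "c\<^sup>2"]
    have 1: "((\<lambda>s. (\<Sum>i\<in>UNIV. (J (p + s *\<^sub>R v) $ i)\<^sup>2) / c\<^sup>2) has_real_derivative
        2 * (\<Sum>i\<in>UNIV. J p $ i * dir_deriv v (\<lambda>q. J q $ i) p) / c\<^sup>2) (at 0)"
      by (simp add: sum_distrib_left)
    have 2: "((\<lambda>s. (\<rho> (p + s *\<^sub>R v))\<^sup>2) has_real_derivative 2 * (\<rho> p * dir_deriv v \<rho> p)) (at 0)"
      using DERIV_power[OF d\<rho>[of p v], of 2] by (simp add: mult_ac)
    show ?thesis
      using DERIV_cdivide[OF DERIV_add[OF 2 1], of 2] by (simp add: e_def add_divide_distrib)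
  qed
  have dE: "((\<lambda>s. w (p + s *\<^sub>R (0, 1)) * e (p + s *\<^sub>R (0, 1))) has_real_derivative E' p) (at 0)" for p
    using DERIV_mult[OF dw[of p "(0, 1)"] de[of p "(0, 1)"]]
    by (simp add: E'_def time_deriv_def mult_ac del: scaleR_Pair)
  have dX: "((\<lambda>s. w (p + s *\<^sub>R (axis i 1, 0)) * (\<rho> (p + s *\<^sub>R (axis i 1, 0)) * J (p + s *\<^sub>R (axis i 1, 0)) $ i))
      has_real_derivative X' i p) (at 0)" for i p
    using DERIV_mult[OF dw[of p "(axis i 1, 0)"] DERIV_mult[OF d\<rho>[of p "(axis i 1, 0)"] dJ[of p "(axis i 1, 0)" i]]]
    by (simp add: X'_def space_deriv_def inner_axis algebra_simps del: scaleR_Pair)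
  have [continuous_intros]: "continuous_on UNIV \<psi>" "continuous_on UNIV y" "continuous_on UNIV S"
    unfolding \<psi>_def[abs_def] y_def[abs_def] S_def[abs_def] by (intro continuous_intros)+
  have S0: "S p \<noteq> 0" for p using S1[of p] by auto
  note cont = C_infinity_continuous[OF smooth_\<rho>] C_infinity_continuous[OF smooth_J]
    C_infinity_continuous[OF C_infinity_dir_deriv[OF smooth_\<rho> axis_in_Basis_spacetime(1)]]
    C_infinity_continuous[OF C_infinity_dir_deriv[OF smooth_J axis_in_Basis_spacetime(1)]]
    C_infinity_continuous[OF C_infinity_dir_deriv[OF smooth_\<rho> axis_in_Basis_spacetime(2)]]
    C_infinity_continuous[OF C_infinity_dir_deriv[OF smooth_J axis_in_Basis_spacetime(2)]]
  have cw: "continuous_on UNIV w"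
    unfolding w_def[abs_def] by (intro continuous_intros)
  have ce: "continuous_on UNIV e"
    unfolding e_def[abs_def] using c by (intro continuous_intros cont) auto
  have cE': "continuous_on UNIV E'"
    unfolding E'_def[abs_def] time_deriv_def using c by (intro continuous_intros cont cw ce) auto
  have cX': "continuous_on UNIV (X' i)" for i
    unfolding X'_def[abs_def] space_deriv_def by (intro continuous_intros cont cw) (use S0 in auto)
  \<comment> \<open>Where \<open>\<psi> > 0\<close> and the fields do not vanish, \<open>t\<^sub>0 < t \<le> 0\<close> and \<open>|x - x\<^sub>0| < c |t\<^sub>0| + 1\<close>.\<close>
  define R where "R = norm x\<^sub>0 + c * \<bar>t\<^sub>0\<bar> + 1 + \<bar>t\<^sub>0\<bar>"
  have supp: "w p = 0 \<or> \<rho> p = 0 \<and> J p = 0" if "p \<notin> ball 0 R" for p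
  proof (rule ccontr)
    assume "\<not> ?thesis"
    then have \<psi>: "\<psi> p > 0" and "\<not> snd p > 0"
      using future[of "snd p" "fst p"] by (auto simp: w_def max_def split: if_splits)
    then have t: "snd p \<le> 0" by simp
    have "c * (snd p - t\<^sub>0) > 0"
      using \<psi> S1[of p] by (simp add: \<psi>_def)
    then have t0: "snd p > t\<^sub>0" using c by (simp add: zero_less_mult_iff)
    have "norm (y p) < c * (snd p - t\<^sub>0) + 1"
      using \<psi> Sy[of p] by (simp add: \<psi>_def)
    also have "\<dots> \<le> c * \<bar>t\<^sub>0\<bar> + 1"
      using t t0 c by (intro add_right_mono mult_left_mono) auto
    finally have "norm (fst p) < norm x\<^sub>0 + c * \<bar>t\<^sub>0\<bar> + 1"
      using norm_triangle_ineq[of "y p" x\<^sub>0] by (simp add: y_def)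
    moreover have "norm p \<le> norm (fst p) + \<bar>snd p\<bar>"
      using norm_Pair_le[of "fst p" "snd p"] by simp
    ultimately have "norm p < R" using t t0 by (simp add: R_def)
    then show False using that by simp
  qed
  have iE: "(E' has_integral 0) UNIV"
  proof (rule has_integral_directional_derivative_0[OF dE _ cE'])
    show "continuous_on UNIV (\<lambda>p. w p * e p)" by (intro continuous_on_mult cw ce)
    show "w p * e p = 0" if "p \<notin> ball 0 R" for p
      using supp[OF that] by (auto simp: e_def)
  qed
  have iX: "(X' i has_integral 0) UNIV" for i
  proof (rule has_integral_directional_derivative_0[OF dX _ cX'])
    show "continuous_on UNIV (\<lambda>p. w p * (\<rho> p * J p $ i))" by (intro continuous_on_mult cw cont)
    show "w p * (\<rho> p * J p $ i) = 0" if "p \<notin> ball 0 R" for p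
      using supp[OF that] by auto
  qed
  define D where "D p = 2 * max 0 (\<psi> p) * (c * e p - \<rho> p * (y p \<bullet> J p) / S p)" for p
  have D_eq: "D p = E' p + (\<Sum>i\<in>UNIV. X' i p)" for p
  proof -
    let ?m = "2 * max 0 (\<psi> p)"
    have "X' i p = (- ?m * \<rho> p / S p) * (y p $ i * J p $ i)
        + (w p * (J p $ i * space_deriv i \<rho> p) + w p * \<rho> p * space_deriv i (\<lambda>q. J q $ i) p)" for i
      by (simp add: X'_def distrib_left mult_ac)
    then have "(\<Sum>i\<in>UNIV. X' i p) = (- ?m * \<rho> p / S p) * (y p \<bullet> J p)
        + (w p * (\<Sum>i\<in>UNIV. J p $ i * space_deriv i \<rho> p) + w p * \<rho> p * divergence J p)"
      by (simp only: sum.distrib inner_vec_def inner_real_def divergence_def sum_distrib_left)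
    moreover have "(\<Sum>i\<in>UNIV. J p $ i * space_deriv i \<rho> p)
        = - ((\<Sum>i\<in>UNIV. J p $ i * time_deriv (\<lambda>q. J q $ i) p) / c\<^sup>2)"
    proof -
      have "space_deriv i \<rho> p = - (time_deriv (\<lambda>q. J q $ i) p / c\<^sup>2)" for i
        using momentum[of i p] by simp
      then show ?thesis by (simp add: sum_negf sum_divide_distrib)
    qed
    moreover have "time_deriv \<rho> p = - divergence J p" using mass[of p] by simp
    ultimately show ?thesis
      by (simp add: D_def E'_def distrib_left right_diff_distrib)
  qed
  have iD: "(D has_integral 0) UNIV"
    using has_integral_add[OF iE has_integral_sum[of UNIV, OF finite iX]] unfolding D_eq[abs_def] by simp
  have cD: "continuous_on UNIV D"
    unfolding D_eq[abs_def] by (intro continuous_intros cE' cX')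
  have "D p \<ge> 0" for p
  proof -
    have "\<rho> p * (y p \<bullet> J p) \<le> \<bar>\<rho> p\<bar> * \<bar>y p \<bullet> J p\<bar>"
      by (simp add: abs_mult[symmetric])
    also have "\<dots> \<le> \<bar>\<rho> p\<bar> * (norm (y p) * norm (J p))"
      by (intro mult_left_mono Cauchy_Schwarz_ineq2) simp
    also have "\<dots> \<le> \<bar>\<rho> p\<bar> * (S p * norm (J p))"
      by (intro mult_left_mono mult_right_mono Sy) auto
    finally have "\<rho> p * (y p \<bullet> J p) / S p \<le> \<bar>\<rho> p\<bar> * norm (J p)"
      using S1[of p] by (simp add: pos_divide_le_eq mult_ac)
    also have "\<dots> \<le> c * e p"
    proof -
      have "(norm (J p))\<^sup>2 = (\<Sum>i\<in>UNIV. (J p $ i)\<^sup>2)"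
        by (subst power2_norm_eq_inner) (simp add: inner_vec_def power2_eq_square)
      then have "e p = ((\<rho> p)\<^sup>2 + (norm (J p))\<^sup>2 / c\<^sup>2) / 2" by (simp add: e_def)
      then have "c * e p - \<bar>\<rho> p\<bar> * norm (J p) = (c * \<bar>\<rho> p\<bar> - norm (J p))\<^sup>2 / (2 * c)"
        using c by (simp add: power2_diff field_simps power2_eq_square)
      also have "\<dots> \<ge> 0" using c by simp
      finally show ?thesis by simp
    qed
    finally show ?thesis by (simp add: D_def)
  qed
  from continuous_nonneg_integral_0[OF cD this iD] have "D p\<^sub>1 = 0" .
  moreover have "y p\<^sub>1 = 0" "\<psi> p\<^sub>1 = c"
    by (simp_all add: \<psi>_def S_def y_def x\<^sub>0_def t\<^sub>0_def)
  ultimately have "e p\<^sub>1 = 0" using c by (simp add: D_def)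
  moreover have "(\<Sum>i\<in>UNIV. (J p\<^sub>1 $ i)\<^sup>2) / c\<^sup>2 \<ge> 0"
    by (intro divide_nonneg_nonneg sum_nonneg) auto
  ultimately have "(\<rho> p\<^sub>1)\<^sup>2 = 0" "(\<Sum>i\<in>UNIV. (J p\<^sub>1 $ i)\<^sup>2) / c\<^sup>2 = 0"
    by (auto simp: e_def add_nonneg_eq_0_iff)
  then show ?thesis
    using c by (simp add: sum_nonneg_eq_0_iff vec_eq_iff)
qed

section \<open>Decaying functions that are harmonic or constant on rays\<close>

lemma schwartz_tendsto_0:
  fixes f :: "'a::euclidean_space \<Rightarrow> 'b::real_normed_vector"
  assumes "schwartz f"
  shows "(f \<longlongrightarrow> 0) at_infinity"
proof -
  have "\<forall>n vs. set vs \<subseteq> Basis \<longrightarrow> bounded (range (\<lambda>x. norm x ^ n *\<^sub>R iter_partial vs f x))"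
    using assms by (simp add: schwartz_def)
  from this[rule_format, of "[]" 1] obtain B where B: "\<And>x. norm x * norm (f x) \<le> B"
    by (auto simp: bounded_iff iter_partial_def)
  show ?thesis
  proof (rule Lim_null_comparison)
    show "\<forall>\<^sub>F x in at_infinity. norm (f x) \<le> B / norm x"
      unfolding eventually_at_infinity
    proof (intro exI[of _ 1] allI impI)
      fix x :: 'a assume "1 \<le> norm x"
      then have "norm x > 0" by linarith
      then show "norm (f x) \<le> B / norm x"
        using B[of x] by (simp add: pos_le_divide_eq mult.commute)
    qed
    show "((\<lambda>x::'a. B / norm x) \<longlongrightarrow> 0) at_infinity"
      by (intro tendsto_divide_0[OF tendsto_const] filterlim_at_top_imp_at_infinity filterlim_norm_at_top)
  qed
qed

text \<open>The hypothesis is Euler's equation \<open>x \<bullet> \<nabla>f(x) = 0\<close>, written as a derivative along the line through \<open>x\<close>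
  in direction \<open>x\<close>. Then \<open>f\<close> is constant on open rays, where the decay makes it zero; continuity takes
  care of the origin.\<close>

lemma radially_constant_decaying_eq_0:
  fixes f :: "'a::euclidean_space \<Rightarrow> real"
  assumes radial: "\<And>x. ((\<lambda>s. f (x + s *\<^sub>R x)) has_real_derivative 0) (at 0)"
    and cont: "continuous_on UNIV f" and decay: "(f \<longlongrightarrow> 0) at_infinity"
  shows "f x = 0"
proof -
  have nonzero: "f x = 0" if "x \<noteq> 0" for x
  proof -
    have "((\<lambda>s. f (s *\<^sub>R x)) has_real_derivative 0) (at s within {0<..})" if "s > 0" for s
    proof (rule has_field_derivative_at_within)
      \<comment> \<open>Seen from \<open>s x\<close>, the point \<open>u x\<close> is displaced by the multiple \<open>(u - s) / s\<close> of \<open>s x\<close> itself.\<close>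
      have *: "((\<lambda>h. f (s *\<^sub>R x + h *\<^sub>R (s *\<^sub>R x))) has_real_derivative 0) (at ((\<lambda>u. (u - s) / s) s))"
        using radial[of "s *\<^sub>R x"] by simp
      have "((\<lambda>u. (u - s) / s) has_real_derivative 1 / s) (at s)"
        using that by (auto intro!: derivative_eq_intros)
      from DERIV_chain2[OF * this]
      have "((\<lambda>u. f (s *\<^sub>R x + ((u - s) / s) *\<^sub>R (s *\<^sub>R x))) has_real_derivative 0) (at s)"
        by simp
      moreover have "s *\<^sub>R x + ((u - s) / s) *\<^sub>R (s *\<^sub>R x) = u *\<^sub>R x" for u
        using that by (simp flip: scaleR_left.add)
      ultimately show "((\<lambda>s. f (s *\<^sub>R x)) has_real_derivative 0) (at s)" by simp
    qed
    then obtain c where c: "\<And>s. s > 0 \<Longrightarrow> f (s *\<^sub>R x) = c"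
      using has_field_derivative_zero_constant[of "{0<..}" "\<lambda>s. f (s *\<^sub>R x)"] by auto
    have "filterlim (\<lambda>s. s *\<^sub>R x) at_infinity at_top"
      unfolding filterlim_at_infinity_conv_norm_at_top
    proof (rule filterlim_at_top_mono)
      show "filterlim (\<lambda>s. norm x * s) at_top at_top"
        using that by (intro filterlim_tendsto_pos_mult_at_top[OF tendsto_const _ filterlim_ident]) simp
      have "norm x * s \<le> norm (s *\<^sub>R x)" for s
        by (simp add: mult.commute mult_right_mono)
      then show "\<forall>\<^sub>F s in at_top. norm x * s \<le> norm (s *\<^sub>R x)"
        by (intro always_eventually allI)
    qed
    from filterlim_compose[OF decay this] have "((\<lambda>s. f (s *\<^sub>R x)) \<longlongrightarrow> 0) at_top" .
    moreover have "((\<lambda>s. f (s *\<^sub>R x)) \<longlongrightarrow> c) at_top"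
      by (rule tendsto_eventually) (use c in \<open>auto intro: eventually_mono[OF eventually_gt_at_top[of 0]]\<close>)
    ultimately have "c = 0" using tendsto_unique trivial_limit_at_top_linorder by blast
    then show ?thesis using c[of 1] by simp
  qed
  show ?thesis
  proof (cases "x = 0")
    case True
    obtain b :: 'a where b: "b \<in> Basis" using nonempty_Basis by blast
    have "(\<lambda>n. inverse (real (Suc n)) *\<^sub>R b) \<longlonglongrightarrow> 0 *\<^sub>R b"
      by (intro tendsto_intros LIMSEQ_inverse_real_of_nat)
    then have "(\<lambda>n. f (inverse (real (Suc n)) *\<^sub>R b)) \<longlonglongrightarrow> f 0"
      by (intro continuous_on_tendsto_compose[OF cont]) auto
    moreover have "f (inverse (real (Suc n)) *\<^sub>R b) = 0" for n
      by (rule nonzero) (use b in auto)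
    ultimately show ?thesis using True by (simp add: LIMSEQ_const_iff)
  qed (rule nonzero)
qed

lemma second_derivative_nonpos_at_max:
  fixes f f' :: "real \<Rightarrow> real"
  assumes f: "\<And>s. \<bar>s\<bar> < d \<Longrightarrow> (f has_real_derivative f' s) (at s)"
    and f': "(f' has_real_derivative l) (at 0)"
    and "d > 0" and max: "\<And>s. \<bar>s\<bar> < d \<Longrightarrow> f s \<le> f 0"
  shows "l \<le> 0"
proof (rule ccontr)
  assume "\<not> l \<le> 0"
  then obtain h where h: "h > 0" "\<And>s. 0 < s \<Longrightarrow> s < h \<Longrightarrow> f' 0 < f' s"
    using DERIV_pos_inc_right[OF f'] by force
  have "f' 0 = 0"
    using DERIV_local_max[OF f[of 0] \<open>d > 0\<close>] \<open>d > 0\<close> max by auto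
  define r where "r = min (h/2) (d/2)"
  have r: "0 < r" "r < h" "r < d" using h(1) \<open>d > 0\<close> by (auto simp: r_def)
  have "f 0 < f r"
  proof (rule DERIV_pos_imp_increasing_open[OF r(1)])
    show "\<exists>y. (f has_real_derivative y) (at s) \<and> y > 0" if "0 < s" "s < r" for s
      using f[of s] h(2)[of s] \<open>f' 0 = 0\<close> r that by auto
    show "continuous_on {0..r} f"
      by (intro continuous_at_imp_continuous_on ballI DERIV_isCont[OF f]) (use r in auto)
  qed
  with max[of r] r show False by simp
qed

text \<open>The weak maximum principle: if \<open>u z > 0\<close>, add the strictly subharmonic function
  \<open>\<epsilon> |x - z|\<^sup>2\<close> with \<open>\<epsilon>\<close> so small that on a large sphere around \<open>z\<close> the sum stays below \<open>u z\<close>. Then it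
  has an interior maximum in the ball, where all its pure second derivatives are nonpositive although they add up
  to \<open>2 \<epsilon> d > 0\<close> in dimension \<open>d\<close>.\<close>

lemma decaying_harmonic_nonpos:
  fixes u :: "'a::euclidean_space \<Rightarrow> real"
  assumes u': "\<And>b x. b \<in> Basis \<Longrightarrow> ((\<lambda>s. u (x + s *\<^sub>R b)) has_real_derivative u' b x) (at 0)"
    and u'': "\<And>b x. b \<in> Basis \<Longrightarrow> ((\<lambda>s. u' b (x + s *\<^sub>R b)) has_real_derivative u'' b x) (at 0)"
    and harmonic: "\<And>x. (\<Sum>b\<in>Basis. u'' b x) = 0"
    and cont: "continuous_on UNIV u"
    and decay: "(u \<longlongrightarrow> 0) at_infinity"
  shows "u z \<le> 0"
proof (rule ccontr)
  assume "\<not> u z \<le> 0"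
  then have uz: "u z > 0" by simp
  have "\<forall>\<^sub>F x in at_infinity. u x < u z / 2"
    using decay uz by (intro order_tendstoD) auto
  then obtain B where B: "\<And>x. norm x \<ge> B \<Longrightarrow> u x < u z / 2"
    by (auto simp: eventually_at_infinity)
  define R where "R = \<bar>B\<bar> + norm z + 1"
  have R: "R > 0" by (simp add: R_def add_nonneg_pos)
  have uR: "u x < u z / 2" if "norm (x - z) = R" for x
    using that norm_triangle_ineq4[of x z] by (intro B) (simp add: R_def)
  \<comment> \<open>This choice adds only \<open>u z / 4\<close> on the sphere, where \<open>u < u z / 2\<close>.\<close>
  define \<epsilon> where "\<epsilon> = u z / (4 * R\<^sup>2)"
  have \<epsilon>: "\<epsilon> > 0" using uz R by (simp add: \<epsilon>_def)
  define w where "w x = u x + \<epsilon> * ((x - z) \<bullet> (x - z))" for x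
  have "continuous_on (cball z R) w"
    unfolding w_def[abs_def] by (intro continuous_intros continuous_on_subset[OF cont]) auto
  moreover have "cball z R \<noteq> {}" using R by simp
  ultimately obtain m where m: "m \<in> cball z R" and max: "\<And>x. x \<in> cball z R \<Longrightarrow> w x \<le> w m"
    using continuous_attains_sup[of "cball z R" w] by auto
  have "norm (m - z) \<noteq> R"
  proof
    assume eq: "norm (m - z) = R"
    then have "w m < u z / 2 + \<epsilon> * R\<^sup>2"
      using uR[of m] by (simp add: w_def flip: power2_norm_eq_inner)
    also have "\<dots> \<le> u z" using R uz by (simp add: \<epsilon>_def)
    also have "\<dots> = w z" by (simp add: w_def)
    also have "\<dots> \<le> w m" using R by (intro max) auto
    finally show False by simp
  qed
  with m have "m \<in> ball z R" by (simp add: dist_norm norm_minus_commute)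
  then obtain d where d: "d > 0" "ball m d \<subseteq> cball z R"
    by (meson ball_subset_cball open_ball open_contains_ball order_trans)
  have "u'' b m + 2 * \<epsilon> \<le> 0" if b: "b \<in> Basis" for b
  proof (rule second_derivative_nonpos_at_max[of d])
    let ?w' = "\<lambda>s. u' b (m + s *\<^sub>R b) + \<epsilon> * (2 * ((m - z) \<bullet> b) + 2 * s)"
    fix s
    have "w (m + s *\<^sub>R b) = u (m + s *\<^sub>R b) + \<epsilon> * ((m - z) \<bullet> (m - z) + 2 * s * ((m - z) \<bullet> b) + s\<^sup>2)" for s
      using b by (simp add: w_def algebra_simps inner_commute power2_eq_square)
    moreover have "((\<lambda>s. u (m + s *\<^sub>R b)) has_real_derivative u' b (m + s *\<^sub>R b)) (at s)"
      by (rule line_derivative_shift) (rule u'[OF b])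
    then have "((\<lambda>s. u (m + s *\<^sub>R b) + \<epsilon> * ((m - z) \<bullet> (m - z) + 2 * s * ((m - z) \<bullet> b) + s\<^sup>2))
        has_real_derivative ?w' s) (at s)"
      by (auto intro!: derivative_eq_intros)
    ultimately show "((\<lambda>s. w (m + s *\<^sub>R b)) has_real_derivative ?w' s) (at s)"
      by simp
    show "w (m + s *\<^sub>R b) \<le> w (m + 0 *\<^sub>R b)" if "\<bar>s\<bar> < d"
    proof -
      have "m + s *\<^sub>R b \<in> ball m d" using that b by (simp add: dist_norm)
      then show ?thesis using d(2) max by auto
    qed
    show "(?w' has_real_derivative u'' b m + 2 * \<epsilon>) (at 0)"
      using u''[OF b, of m] by (auto intro!: derivative_eq_intros)
  qed fact
  then have "(\<Sum>b\<in>(Basis :: 'a set). u'' b m + 2 * \<epsilon>) \<le> 0"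
    by (intro sum_nonpos) auto
  then show False using harmonic[of m] \<epsilon> by (simp add: sum.distrib mult_le_0_iff)
qed

section \<open>Tangential currents\<close>

lemma tangential_current_trivial:
  fixes \<rho> :: "spacetime \<Rightarrow> real" and J :: "spacetime \<Rightarrow> real^3"
  assumes c: "c > 0"
    and \<rho>: "smoothly_decaying \<rho>" and J: "smoothly_decaying_field J"
    and continuity: "\<And>p. time_deriv \<rho> p + divergence J p = 0"
    and wave_J: "\<And>p. dalembertian_field c J p = 0"
    and momentum: "\<And>p i. space_deriv i \<rho> p + 1 / c\<^sup>2 * time_deriv (\<lambda>q. J q $ i) p = 0"
    and tangential: "\<And>x t. x \<noteq> 0 \<Longrightarrow> t \<ge> 0 \<Longrightarrow> x \<bullet> J (x, t) = 0"
  shows "\<rho> p = 0 \<and> J p = 0"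
proof -
  have smooth_\<rho>: "C_infinity \<rho>" and decay_\<rho>: "\<And>t. schwartz (\<lambda>x. \<rho> (x, t))"
    using \<rho> by (auto simp: smoothly_decaying_def)
  have smooth_J: "\<And>i. C_infinity (\<lambda>p. J p $ i)" and decay_J: "\<And>i t. schwartz (\<lambda>x. J (x, t) $ i)"
    using J by (auto simp: smoothly_decaying_field_def smoothly_decaying_def)
  have smooth_Jt: "\<And>i. C_infinity (time_deriv (\<lambda>p. J p $ i))"
    unfolding time_deriv_def by (intro C_infinity_dir_deriv smooth_J axis_in_Basis_spacetime)
  note line = frechet_has_real_derivative_line[OF C_infinity_differentiable]
  have cont_slice: "continuous_on UNIV (\<lambda>x. u (x, t))" if "C_infinity u" for u :: "spacetime \<Rightarrow> real" and t
    by (intro continuous_on_compose2[OF C_infinity_continuous[OF that]] continuous_intros) auto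
  \<comment> \<open>The tangency condition is differentiated in \<open>t\<close>, which requires it on both sides of \<open>t\<close>.\<close>
  have \<rho>0: "\<rho> (x, t) = 0" if t: "t > 0" for x t
  proof (rule radially_constant_decaying_eq_0[of "\<lambda>x. \<rho> (x, t)"])
    fix x
    have "((\<lambda>s. \<Sum>i\<in>UNIV. x $ i * J ((x, t) + s *\<^sub>R (0, 1)) $ i) has_real_derivative
        (\<Sum>i\<in>UNIV. x $ i * time_deriv (\<lambda>q. J q $ i) (x, t))) (at 0)"
      unfolding time_deriv_def by (intro DERIV_sum DERIV_cmult line smooth_J)
    then have "(\<Sum>i\<in>UNIV. x $ i * time_deriv (\<lambda>q. J q $ i) (x, t)) = 0"
    proof (rule DERIV_zero_near[OF _ t])
      fix s :: real assume "\<bar>s\<bar> < t"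
      then have "x \<bullet> J (x, t + s) = 0"
        using tangential[of x "t + s"] by (cases "x = 0") auto
      then show "(\<Sum>i\<in>UNIV. x $ i * J ((x, t) + s *\<^sub>R (0, 1)) $ i) = 0"
        by (simp add: inner_vec_def)
    qed
    moreover have "space_deriv i \<rho> (x, t) = - 1 / c\<^sup>2 * time_deriv (\<lambda>q. J q $ i) (x, t)" for i
      using momentum[of i "(x, t)"] by simp
    then have "dir_deriv (x, 0) \<rho> (x, t) = - 1 / c\<^sup>2 * (\<Sum>i\<in>UNIV. x $ i * time_deriv (\<lambda>q. J q $ i) (x, t))"
      by (simp add: dir_deriv_spatial C_infinity_differentiable[OF smooth_\<rho>] sum_distrib_left mult_ac
          del: mult_minus_left)
    ultimately have "dir_deriv (x, 0) \<rho> (x, t) = 0" by simp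
    then show "((\<lambda>s. \<rho> (x + s *\<^sub>R x, t)) has_real_derivative 0) (at 0)"
      using line[OF smooth_\<rho>, of "(x, t)" "(x, 0)"] by simp
  qed (intro cont_slice smooth_\<rho> schwartz_tendsto_0 decay_\<rho>)+
  have Jt0: "time_deriv (\<lambda>q. J q $ i) (x, t) = 0" if t: "t > 0" for x t i
  proof -
    have "space_deriv i \<rho> (x, t) = 0"
      unfolding space_deriv_def
      by (rule DERIV_zero_near[OF line[OF smooth_\<rho>] zero_less_one]) (simp add: \<rho>0[OF t])
    then show ?thesis using momentum[of i "(x, t)"] c by simp
  qed
  have J0: "J (x, t) $ i = 0" if t: "t > 0" for x t i
  proof -
    let ?u = "\<lambda>q. J q $ i"
    have "dir_deriv (0, 1) (time_deriv ?u) (x, t) = 0" for x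
      by (rule DERIV_zero_near[OF line[OF smooth_Jt] t]) (simp add: Jt0)
    then have "time_deriv (time_deriv ?u) (x, t) = 0" for x
      by (simp only: time_deriv_def)
    moreover have "dalembertian c ?u (x, t) = 0" for x
      using arg_cong[OF wave_J, of "\<lambda>v. v $ i"] by (simp add: dalembertian_field_def)
    ultimately have "laplacian ?u (x, t) = 0" for x
      by (simp add: dalembertian_def)
    moreover have "(\<Sum>b\<in>Basis. dir_deriv (b, 0) (dir_deriv (b, 0) ?u) (x, t)) = laplacian ?u (x, t)" for x
    proof -
      have B: "(Basis :: (real^3) set) = range (\<lambda>j. axis j 1)" by (auto simp: Basis_vec_def)
      have I: "inj (\<lambda>j::3. axis j (1::real))" by (auto simp: inj_on_def axis_eq_axis)
      show ?thesis
        unfolding B sum.reindex[OF I] laplacian_def space_deriv_def by simp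
    qed
    ultimately have harmonic: "(\<Sum>b\<in>Basis. dir_deriv (b, 0) (dir_deriv (b, 0) ?u) (x, t)) = 0" for x
      by simp
    have spatial: "(b, 0) \<in> (Basis :: spacetime set)" if "b \<in> Basis" for b
      using that by (simp add: Basis_prod_def)
    have d1: "((\<lambda>s. ?u (x + s *\<^sub>R b, t)) has_real_derivative dir_deriv (b, 0) ?u (x, t)) (at 0)" for b x
      using line[OF smooth_J[of i], of "(x, t)" "(b, 0)"] by simp
    have d2: "((\<lambda>s. dir_deriv (b, 0) ?u (x + s *\<^sub>R b, t)) has_real_derivative
        dir_deriv (b, 0) (dir_deriv (b, 0) ?u) (x, t)) (at 0)" if "b \<in> Basis" for b x
      using line[OF C_infinity_dir_deriv[OF smooth_J[of i] spatial[OF that]], of "(x, t)" "(b, 0)"] by simp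
    have "?u (x, t) \<le> 0"
      by (rule decaying_harmonic_nonpos[of "\<lambda>x. ?u (x, t)", OF d1 d2 harmonic])
         (intro cont_slice smooth_J schwartz_tendsto_0 decay_J | assumption)+
    moreover have "- ?u (x, t) \<le> 0"
      by (rule decaying_harmonic_nonpos[of "\<lambda>x. - ?u (x, t)", OF DERIV_minus[OF d1] DERIV_minus[OF d2]])
         (use harmonic tendsto_minus[OF schwartz_tendsto_0[OF decay_J]]
             continuous_on_minus[OF cont_slice[OF smooth_J]] in \<open>auto simp: sum_negf\<close>)
    ultimately show ?thesis by simp
  qed
  show ?thesis
    by (rule acoustic_backward_uniqueness[OF c smooth_\<rho> smooth_J continuity momentum])
       (auto simp: \<rho>0 J0 vec_eq_iff)
qed

section \<open>Amplitude relations and triviality of tangential pairs\<close>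

theorem lemma3p1:
  fixes \<epsilon>\<^sub>0 \<mu>\<^sub>0 c :: real
    and \<rho> :: "spacetime \<Rightarrow> real"
    and J :: "spacetime \<Rightarrow> real^3"
  assumes "\<epsilon>\<^sub>0 > 0" and "\<mu>\<^sub>0 > 0" and "c = 1 / sqrt (\<mu>\<^sub>0 * \<epsilon>\<^sub>0)"
    and "smoothly_decaying \<rho>" and "smoothly_decaying_field J"
    and continuity: "\<And>p. time_deriv \<rho> p + divergence J p = 0"
    and wave_\<rho>: "\<And>p. dalembertian c \<rho> p = 0"
    and wave_J: "\<And>p. dalembertian_field c J p = 0"
    and extra: "\<And>p. gradient \<rho> p + (1 / c\<^sup>2) *\<^sub>R time_deriv J p = 0"
  shows
    "(\<forall>(f :: real^3 \<Rightarrow> complex) (g :: real^3 \<Rightarrow> complex)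
       (F :: real^3 \<Rightarrow> complex^3) (G :: real^3 \<Rightarrow> complex^3).
        schwartz f \<and> schwartz g \<and>
        (\<forall>i. schwartz (\<lambda>k. F k $ i)) \<and> (\<forall>i. schwartz (\<lambda>k. G k $ i)) \<and>
        (\<forall>x t. complex_of_real (\<rho> (x, t)) =
             (LINT k|lborel. f k * exp (\<i> * of_real (k \<bullet> x - angular_freq c k * t)))
           + (LINT k|lborel. g k * exp (\<i> * of_real (k \<bullet> x + angular_freq c k * t)))) \<and>
        (\<forall>x t. cvec (J (x, t)) =
             (LINT k|lborel. exp (\<i> * of_real (k \<bullet> x - angular_freq c k * t)) *s F k)
           + (LINT k|lborel. exp (\<i> * of_real (k \<bullet> x + angular_freq c k * t)) *s G k))
        \<longrightarrow> (\<forall>k. k \<noteq> 0 \<longrightarrow>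
               F k = (of_real c * f k / of_real (norm k)) *s cvec k \<and>
               f k = bilin_dot (cvec k) (F k) / of_real (c * norm k) \<and>
               G k = - ((of_real c * g k / of_real (norm k)) *s cvec k) \<and>
               g k = - (bilin_dot (cvec k) (G k) / of_real (c * norm k))))
     \<and> ((\<forall>x t. x \<noteq> 0 \<and> t \<ge> 0 \<longrightarrow> x \<bullet> J (x, t) = 0)
          \<longrightarrow> (\<forall>p. \<rho> p = 0) \<and> (\<forall>p. J p = 0))"
proof -
  have c: "c > 0" using assms(1-3) by simp
  have smooth_\<rho>: "C_infinity \<rho>" and smooth_J: "C_infinity (\<lambda>p. J p $ i)" for i
    using assms(4,5) by (auto simp: smoothly_decaying_def smoothly_decaying_field_def)
  have momentum: "space_deriv i \<rho> p + 1 / c\<^sup>2 * time_deriv (\<lambda>q. J q $ i) p = 0" for i p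
  proof -
    have "time_deriv J p $ i = time_deriv (\<lambda>q. J q $ i) p"
      unfolding time_deriv_def by (intro dir_deriv_vec_nth C_infinity_differentiable smooth_J)
    then show ?thesis
      using arg_cong[OF extra[of p], of "\<lambda>v. v $ i"] by (simp add: gradient_def)
  qed
  have amplitudes: "F k = (of_real c * f k / of_real (norm k)) *s cvec k \<and>
      f k = bilin_dot (cvec k) (F k) / of_real (c * norm k) \<and>
      G k = - ((of_real c * g k / of_real (norm k)) *s cvec k) \<and>
      g k = - (bilin_dot (cvec k) (G k) / of_real (c * norm k))"
    if f: "schwartz f" and g: "schwartz g"
      and F: "\<And>i. schwartz (\<lambda>k. F k $ i)" and G: "\<And>i. schwartz (\<lambda>k. G k $ i)"
      and \<rho>_eq: "\<And>x t. complex_of_real (\<rho> (x, t)) =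
             (LINT k|lborel. f k * exp (\<i> * of_real (k \<bullet> x - angular_freq c k * t)))
           + (LINT k|lborel. g k * exp (\<i> * of_real (k \<bullet> x + angular_freq c k * t)))"
      and J_eq: "\<And>x t. cvec (J (x, t)) =
             (LINT k|lborel. exp (\<i> * of_real (k \<bullet> x - angular_freq c k * t)) *s F k)
           + (LINT k|lborel. exp (\<i> * of_real (k \<bullet> x + angular_freq c k * t)) *s G k)"
      and k: "k \<noteq> 0"
    for f g :: "real^3 \<Rightarrow> complex" and F G :: "real^3 \<Rightarrow> complex^3" and k
  proof -
    let ?\<omega> = "angular_freq c"
    have cont: "continuous_on UNIV ?\<omega>" "continuous_on UNIV (\<lambda>k. - ?\<omega> k)"
      unfolding angular_freq_def[abs_def] by (intro continuous_intros)+
    have \<rho>_packets: "complex_of_real (\<rho> p) = wave_packet (\<lambda>k. - ?\<omega> k) f p + wave_packet ?\<omega> g p" for p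
      using \<rho>_eq[of "fst p" "snd p"] by (simp add: wave_packet_def)
    have component: "(LINT k|lborel. exp (\<i> * of_real (k \<bullet> fst p + \<phi> k * snd p)) *s H k) $ i
        = wave_packet \<phi> (\<lambda>k. H k $ i) p"
      if "continuous_on UNIV \<phi>" and H: "\<And>i. schwartz (\<lambda>k. H k $ i)" for \<phi> i p and H :: "real^3 \<Rightarrow> complex^3"
      using integrable_wave_packet[OF that(1) integrable_schwartz[OF H]]
      by (subst integral_vec_nth) (simp_all add: wave_packet_def mult.commute)
    have J_packets: "complex_of_real (J p $ i) =
        wave_packet (\<lambda>k. - ?\<omega> k) (\<lambda>k. F k $ i) p + wave_packet ?\<omega> (\<lambda>k. G k $ i) p" for p i
      using arg_cong[OF J_eq[of "fst p" "snd p"], of "\<lambda>v. v $ i"]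
        component[OF cont(1) G, of p i] component[OF cont(2) F, of p i]
      by (simp add: cvec_def)
    note amplitude = wave_packet_amplitudes[OF c smooth_\<rho> smooth_J momentum f g F G \<rho>_packets J_packets k]
    have "F k $ i = of_real (c * k $ i / norm k) * f k" for i
      by (rule amplitude(1))
    note F_eq = cvec_projection[OF k less_imp_neq[OF c, symmetric] this]
    have "G k $ i = of_real (c * k $ i / norm k) * - g k" for i
      using amplitude(2)[of i] by simp
    note G_eq = cvec_projection[OF k less_imp_neq[OF c, symmetric] this]
    have "G k = - ((of_real c * g k / of_real (norm k)) *s cvec k)"
      by (subst G_eq(1)) (simp add: vec_eq_iff)
    moreover have "g k = - (bilin_dot (cvec k) (G k) / of_real (c * norm k))"
      by (simp only: G_eq(2)[symmetric] minus_minus)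
    ultimately show ?thesis using F_eq by blast
  qed
  show ?thesis
  proof (intro conjI)
    show "\<forall>f g F G. schwartz f \<and> schwartz g \<and>
        (\<forall>i. schwartz (\<lambda>k. F k $ i)) \<and> (\<forall>i. schwartz (\<lambda>k. G k $ i)) \<and>
        (\<forall>x t. complex_of_real (\<rho> (x, t)) =
             (LINT k|lborel. f k * exp (\<i> * of_real (k \<bullet> x - angular_freq c k * t)))
           + (LINT k|lborel. g k * exp (\<i> * of_real (k \<bullet> x + angular_freq c k * t)))) \<and>
        (\<forall>x t. cvec (J (x, t)) =
             (LINT k|lborel. exp (\<i> * of_real (k \<bullet> x - angular_freq c k * t)) *s F k)
           + (LINT k|lborel. exp (\<i> * of_real (k \<bullet> x + angular_freq c k * t)) *s G k))
        \<longrightarrow> (\<forall>k. k \<noteq> 0 \<longrightarrow>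
               F k = (of_real c * f k / of_real (norm k)) *s cvec k \<and>
               f k = bilin_dot (cvec k) (F k) / of_real (c * norm k) \<and>
               G k = - ((of_real c * g k / of_real (norm k)) *s cvec k) \<and>
               g k = - (bilin_dot (cvec k) (G k) / of_real (c * norm k)))"
      by (intro allI impI, elim conjE, rule amplitudes) blast+
    show "(\<forall>x t. x \<noteq> 0 \<and> t \<ge> 0 \<longrightarrow> x \<bullet> J (x, t) = 0) \<longrightarrow> (\<forall>p. \<rho> p = 0) \<and> (\<forall>p. J p = 0)"
      using tangential_current_trivial[OF c assms(4,5) continuity wave_J momentum] by blast
  qed
qed

end
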